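(* Let $A$ be a convex body in $\mathbb R^n$ and $B$ be a convex open bounded set in $\mathbb R^n$. Assume that, for any vector $t\in\mathbb R^n$, the set $(A+t)\setminus B$ is either empty or acyclic. Then $A$ is a Minkowski summand of $B$, i.e. $A + C = B$ for some convex set $C$ (namely $C = \bigcap_{a\in A}(B-a)$).
   Context: Cohomology is Čech cohomology with coefficients in the constant sheaf $\mathbb Z$, denoted $H^*(X)$. A set $X\subset\mathbb R^n$ is called acyclic if $H^0(X)=\mathbb Z$ and $H^k(X)=0$ for all $k>0$. A convex body is a compact convex set (with nonempty interior) in $\mathbb R^n$. *)

theory Defs
  imports "HOL-Analysis.Analysis" "HOL-Algebra.Elementary_Groups"
begin

section \<open>Direct limits of groups\<close>

text \<open>The direct limit, over an index set \<open>I\<close> directed by \<open>prec\<close>, of groups \<open>G i\<close> with transition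
  homomorphisms \<open>\<rho> i j\<close> from \<open>G i\<close> to \<open>G j\<close> whenever \<open>prec i j\<close>: the disjoint union of
  the carriers, modulo the identification of elements that become equal at some later stage.\<close>

definition direct_limit_rel ::
    "'i set \<Rightarrow> ('i \<Rightarrow> 'i \<Rightarrow> bool) \<Rightarrow> ('i \<Rightarrow> 'g monoid) \<Rightarrow> ('i \<Rightarrow> 'i \<Rightarrow> 'g \<Rightarrow> 'g) \<Rightarrow> (('i \<times> 'g) \<times> ('i \<times> 'g)) set"
  where "direct_limit_rel I prec G \<rho> =
    {((i, x), (j, y)). i \<in> I \<and> j \<in> I \<and> x \<in> carrier (G i) \<and> y \<in> carrier (G j) \<and>
       (\<exists>k\<in>I. prec i k \<and> prec j k \<and> \<rho> i k x = \<rho> j k y)}"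

text \<open>Any two classes have representatives at a common index, where they can be multiplied.\<close>

definition direct_limit ::
    "'i set \<Rightarrow> ('i \<Rightarrow> 'i \<Rightarrow> bool) \<Rightarrow> ('i \<Rightarrow> 'g monoid) \<Rightarrow> ('i \<Rightarrow> 'i \<Rightarrow> 'g \<Rightarrow> 'g) \<Rightarrow> ('i \<times> 'g) set monoid"
  where "direct_limit I prec G \<rho> =
    \<lparr>carrier = (SIGMA i:I. carrier (G i)) // direct_limit_rel I prec G \<rho>,
     mult = (\<lambda>P Q. direct_limit_rel I prec G \<rho> ``
               {(i, x \<otimes>\<^bsub>G i\<^esub> y) | i x y. (i, x) \<in> P \<and> (i, y) \<in> Q}),
     one = direct_limit_rel I prec G \<rho> `` {(i, \<one>\<^bsub>G i\<^esub>) | i. i \<in> I}\<rparr>"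


section \<open>\v{C}ech cohomology with coefficients in the constant sheaf of integers\<close>

subsection \<open>Cohomology of an open cover\<close>

text \<open>Covers are sets of open sets, indexed by themselves. Every indexed open cover has the same
  refinements as the set of its members, so the limit over all covers is the usual one.\<close>

definition open_covers :: "'a topology \<Rightarrow> 'a set set set"
  where "open_covers X = {\<U>. (\<forall>U\<in>\<U>. openin X U) \<and> \<Union>\<U> = topspace X}"

text \<open>A \<open>k\<close>-cochain assigns to every tuple \<open>U\<^sub>0, \<dots>, U\<^sub>k\<close> of members of the cover a section of the
  constant sheaf over \<open>U\<^sub>0 \<inter> \<dots> \<inter> U\<^sub>k\<close>, i.e.\ a locally constant function, which is a continuous map to
  the discrete space of integers. To make cochains unique as HOL functions, they are \<open>0\<close> wherever they have
  no meaning.\<close>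

definition cech_cochains :: "nat \<Rightarrow> 'a topology \<Rightarrow> 'a set set \<Rightarrow> ('a set list \<Rightarrow> 'a \<Rightarrow> int) set"
  where "cech_cochains k X \<U> =
    {c. (\<forall>us\<in>lists \<U>. length us = Suc k \<longrightarrow>
           continuous_map (subtopology X (\<Inter>(set us))) (discrete_topology UNIV) (c us)) \<and>
        (\<forall>us x. \<not> (us \<in> lists \<U> \<and> length us = Suc k \<and> x \<in> \<Inter>(set us)) \<longrightarrow> c us x = 0)}"

definition cech_coboundary ::
    "nat \<Rightarrow> 'a set set \<Rightarrow> ('a set list \<Rightarrow> 'a \<Rightarrow> int) \<Rightarrow> 'a set list \<Rightarrow> 'a \<Rightarrow> int"
  where "cech_coboundary k \<U> c = (\<lambda>us x.
    if us \<in> lists \<U> \<and> length us = Suc (Suc k) \<and> x \<in> \<Inter>(set us)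
    then \<Sum>i\<le>Suc k. (-1) ^ i * c (take i us @ drop (Suc i) us) x else 0)"

definition cech_cocycle_group ::
    "nat \<Rightarrow> 'a topology \<Rightarrow> 'a set set \<Rightarrow> ('a set list \<Rightarrow> 'a \<Rightarrow> int) monoid"
  where "cech_cocycle_group k X \<U> =
    \<lparr>carrier = {c \<in> cech_cochains k X \<U>. cech_coboundary k \<U> c = (\<lambda>us x. 0)},
     mult = (\<lambda>c d us x. c us x + d us x),
     one = (\<lambda>us x. 0)\<rparr>"

definition cech_coboundaries ::
    "nat \<Rightarrow> 'a topology \<Rightarrow> 'a set set \<Rightarrow> ('a set list \<Rightarrow> 'a \<Rightarrow> int) set"
  where "cech_coboundaries k X \<U> =
    (case k of 0 \<Rightarrow> {\<lambda>us x. 0} | Suc l \<Rightarrow> cech_coboundary l \<U> ` cech_cochains l X \<U>)"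

definition cech_cover_group ::
    "nat \<Rightarrow> 'a topology \<Rightarrow> 'a set set \<Rightarrow> ('a set list \<Rightarrow> 'a \<Rightarrow> int) set monoid"
  where "cech_cover_group k X \<U> = cech_cocycle_group k X \<U> Mod cech_coboundaries k X \<U>"


subsection \<open>Refinement and passage to the limit\<close>

definition refined_by :: "'a set set \<Rightarrow> 'a set set \<Rightarrow> bool"
  where "refined_by \<U> \<V> \<longleftrightarrow> (\<forall>V\<in>\<V>. \<exists>U\<in>\<U>. V \<subseteq> U)"

text \<open>Two choices of a refinement projection induce chain homotopic pullbacks, hence the same map
  on cohomology, so that an arbitrary choice is harmless.\<close>

definition refinement_projection :: "'a set set \<Rightarrow> 'a set \<Rightarrow> 'a set"
  where "refinement_projection \<U> V = (SOME U. U \<in> \<U> \<and> V \<subseteq> U)"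

definition cech_pullback ::
    "'a set set \<Rightarrow> ('a set \<Rightarrow> 'a set) \<Rightarrow> ('a set list \<Rightarrow> 'a \<Rightarrow> int) \<Rightarrow> 'a set list \<Rightarrow> 'a \<Rightarrow> int"
  where "cech_pullback \<V> \<tau> c = (\<lambda>vs x. if vs \<in> lists \<V> \<and> x \<in> \<Inter>(set vs) then c (map \<tau> vs) x else 0)"

text \<open>For a cohomology class \<open>h\<close>, i.e.\ a coset, all members of the union below are the same coset.\<close>

definition cech_refinement_map ::
    "nat \<Rightarrow> 'a topology \<Rightarrow> 'a set set \<Rightarrow> 'a set set \<Rightarrow>
     ('a set list \<Rightarrow> 'a \<Rightarrow> int) set \<Rightarrow> ('a set list \<Rightarrow> 'a \<Rightarrow> int) set"
  where "cech_refinement_map k X \<U> \<V> h =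
    (\<Union>c\<in>h. cech_coboundaries k X \<V> #>\<^bsub>cech_cocycle_group k X \<V>\<^esub>
              cech_pullback \<V> (refinement_projection \<U>) c)"

definition cech_cohomology ::
    "nat \<Rightarrow> 'a topology \<Rightarrow> ('a set set \<times> ('a set list \<Rightarrow> 'a \<Rightarrow> int) set) set monoid"
  where "cech_cohomology k X =
    direct_limit (open_covers X) refined_by (cech_cover_group k X) (cech_refinement_map k X)"

definition cech_acyclic :: "'a::topological_space set \<Rightarrow> bool"
  where "cech_acyclic S \<longleftrightarrow>
    cech_cohomology 0 (top_of_set S) \<cong> integer_group \<and>
    (\<forall>k>0. trivial_group (cech_cohomology k (top_of_set S)))"

end

theory Submission
  imports Defs
begin

text \<open>Let \<open>C\<close> be the set of all \<open>t\<close> with \<open>A + t \<subseteq> B\<close>, and suppose that \<open>b \<in> B\<close> is not in \<open>A + C\<close>. Separate \<open>b\<close>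
  from \<open>A + C\<close> by a linear functional \<open>u\<close> and surround \<open>C\<close> by a simplex with one facet in a supporting
  hyperplane of \<open>C\<close> with normal \<open>u\<close>. Over the boundary of this simplex, the space of all \<open>(x, t)\<close> with
  \<open>x \<in> (A + t) - B\<close> has nonempty acyclic fibres, so by the Vietoris--Begle theorem the projection to \<open>t\<close> pulls the
  fundamental class of the sphere back to a nonzero class. But seen from a point of \<open>C\<close> the projection is
  null-homotopic: \<open>t\<close> can be moved to \<open>x - a'\<close> for the point \<open>a'\<close> of \<open>A\<close> where \<open>u\<close> is largest, and the
  points \<open>x\<close> lie in a half-space outside of \<open>B\<close> whose bounding hyperplane meets \<open>B\<close>.\<close>

section \<open>Alexander--Spanier cochains near a subset of a metric space\<close>

text \<open>The sets \<open>(A + t) - B\<close> are compact but may be wild, so the cohomology has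
  to be continuous on compact sets. Alexander--Spanier cochains on short lists have this property,
  and with them gluing, pullback and homotopy become explicit formulas on lists. Two facts shape the
  sphere. As \<open>B\<close> is open, \<open>C\<close> stays strictly on one side of the chosen
  hyperplane with normal \<open>u\<close>, so even the facet in that hyperplane misses
  \<open>C\<close>; this is why every fibre over the boundary is nonempty. As the simplex lies on
  that same side, every \<open>x\<close> in \<open>A + t\<close> over it has
  \<open>u \<bullet> x\<close> at most \<open>\<sigma> + u \<bullet> a'\<close>, which is less than
  \<open>u \<bullet> y\<close> for a point \<open>y\<close> of \<open>B\<close> slightly beyond
  \<open>b\<close>. A simplex serves better than a round sphere: any proper nonempty family of its
  facets meets in a nonempty convex face, while all facets together have no common point. The
  preimages of the facets therefore have acyclic partial intersections and an empty total one, and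
  this pattern alone forces a nonzero class. That \<open>C\<close> has a point at all is not clear
  beforehand; it takes a separate argument of the same kind with a different homotopy.\<close>

text \<open>Cochains are functions on lists of points, indexed by the length of the lists rather than by the
  dimension. The empty list is allowed as an argument, so the resulting cohomology is the reduced one.\<close>

primrec cobd :: "'a list \<Rightarrow> ('a list \<Rightarrow> int) \<Rightarrow> int" where
  "cobd [] f = 0"
| "cobd (x # xs) f = f xs - cobd xs (\<lambda>ys. f (x # ys))"

lemma cobd_diff: "cobd xs (\<lambda>ys. f ys - g ys) = cobd xs f - cobd xs g"
  by (induction xs arbitrary: f g) auto

lemma cobd_add: "cobd xs (\<lambda>ys. f ys + g ys) = cobd xs f + cobd xs g"
  by (induction xs arbitrary: f g) auto

lemma cobd_zero: "cobd xs (\<lambda>ys. 0) = 0"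
  by (induction xs) auto

lemma cobd_cobd: "cobd xs (\<lambda>ys. cobd ys f) = 0"
  by (induction xs arbitrary: f) (auto simp: cobd_diff)

lemma cobd_map: "cobd xs (\<lambda>ys. f (map h ys)) = cobd (map h xs) f"
proof (induction xs arbitrary: f)
  case (Cons x xs)
  show ?case using Cons.IH[of "\<lambda>ys. f (h x # ys)"] by simp
qed simp

text \<open>A coboundary at a list sees only the faces of that list. Hence a cochain patched
  together by a case distinction on small lists may be replaced, on one small list, by the patch
  that applies there.\<close>

lemma cobd_cong:
  assumes "\<And>ys. Suc (length ys) = length xs \<Longrightarrow> set ys \<subseteq> set xs \<Longrightarrow> f ys = g ys"
  shows "cobd xs f = cobd xs g"
  using assms
proof (induction xs arbitrary: f g)
  case (Cons x xs)
  have "f xs = g xs" using Cons.prems[of xs] by auto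
  moreover have "cobd xs (\<lambda>ys. f (x # ys)) = cobd xs (\<lambda>ys. g (x # ys))"
    by (rule Cons.IH, rule Cons.prems) auto
  ultimately show ?case by simp
qed simp

text \<open>The prism operator: an alternating sum over the positions of a list, of \<open>f\<close>
  at the list that follows \<open>p\<close> up to that position and \<open>q\<close> from it on,
  with the vertex there used twice.\<close>

primrec prism :: "('b \<Rightarrow> 'a) \<Rightarrow> ('b \<Rightarrow> 'a) \<Rightarrow> 'b list \<Rightarrow> ('a list \<Rightarrow> int) \<Rightarrow> int" where
  "prism p q [] f = 0"
| "prism p q (x # xs) f = f (p x # q x # map q xs) - prism p q xs (\<lambda>ys. f (p x # ys))"

lemma prism_diff: "prism p q xs (\<lambda>ys. f ys - g ys) = prism p q xs f - prism p q xs g"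
  by (induction xs arbitrary: f g) auto

text \<open>The prism is a chain homotopy between the pullbacks along \<open>p\<close> and
  \<open>q\<close>. The induction peels off the first vertex; the term that switches from
  \<open>p\<close> to \<open>q\<close> at once is handled by naturality of the coboundary.\<close>

lemma prism_homotopy:
  "cobd xs (\<lambda>ys. prism p q ys f) + prism p q xs (\<lambda>ys. cobd ys f) = f (map q xs) - f (map p xs)"
proof (induction xs arbitrary: f)
  case (Cons x xs)
  show ?case
    using Cons.IH[of "\<lambda>ys. f (p x # ys)"] cobd_map[of xs "\<lambda>ys. f (p x # q x # ys)" q]
    by (simp add: cobd_diff prism_diff algebra_simps)
qed simp

lemma prism_eq_0:
  assumes "\<And>ys. length ys = Suc (length xs) \<Longrightarrow> set ys \<subseteq> p ` set xs \<union> q ` set xs \<Longrightarrow> f ys = 0"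
  shows "prism p q xs f = 0"
  using assms
proof (induction xs arbitrary: f)
  case (Cons x xs)
  have "f (p x # q x # map q xs) = 0" by (rule Cons.prems) auto
  moreover have "prism p q xs (\<lambda>ys. f (p x # ys)) = 0"
    by (rule Cons.IH, rule Cons.prems) auto
  ultimately show ?case by simp
qed simp

text \<open>Alexander--Spanier cochains of \<open>Z\<close>: only the values on short lists matter. The lists may leave \<open>Z\<close>,
  by less than \<open>e\<close>; with this choice a cocycle that is trivial on \<open>Z\<close> is automatically trivial on a
  neighbourhood of \<open>Z\<close>, and the excision arguments need no retractions.\<close>

definition small_list :: "real \<Rightarrow> 'a::metric_space set \<Rightarrow> 'a list \<Rightarrow> bool" where
  "small_list e Z xs \<longleftrightarrow>
    (\<forall>x\<in>set xs. \<exists>z\<in>Z. dist x z < e) \<and> (\<forall>x\<in>set xs. \<forall>y\<in>set xs. dist x y < e)"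

definition cocycle_near :: "nat \<Rightarrow> ('a::metric_space list \<Rightarrow> int) \<Rightarrow> 'a set \<Rightarrow> bool" where
  "cocycle_near m f Z \<longleftrightarrow>
    (\<exists>e>0. \<forall>xs. length xs = Suc m \<longrightarrow> small_list e Z xs \<longrightarrow> cobd xs f = 0)"

definition trivial_near :: "nat \<Rightarrow> ('a::metric_space list \<Rightarrow> int) \<Rightarrow> 'a set \<Rightarrow> bool" where
  "trivial_near m f Z \<longleftrightarrow>
    (\<exists>g. \<exists>e>0. \<forall>xs. length xs = m \<longrightarrow> small_list e Z xs \<longrightarrow> f xs = cobd xs g)"

text \<open>Vanishing of reduced cohomology in degree \<open>m - 1\<close>: cochains take lists of
  length \<open>m\<close>, and their coboundary is tested on lists of length \<open>m + 1\<close>.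
  For \<open>m = 0\<close> this says that \<open>Z\<close> is nonempty.\<close>

definition acyclic_in :: "nat \<Rightarrow> 'a::metric_space set \<Rightarrow> bool" where
  "acyclic_in m Z \<longleftrightarrow> (\<forall>f. cocycle_near m f Z \<longrightarrow> trivial_near m f Z)"

lemma small_list_near: "small_list e Z xs \<Longrightarrow> x \<in> set xs \<Longrightarrow> \<exists>z\<in>Z. dist x z < e"
  unfolding small_list_def by simp

lemma small_list_dist: "small_list e Z xs \<Longrightarrow> x \<in> set xs \<Longrightarrow> y \<in> set xs \<Longrightarrow> dist x y < e"
  unfolding small_list_def by simp

lemma small_list_subset: "small_list e Z xs \<Longrightarrow> set ys \<subseteq> set xs \<Longrightarrow> small_list e Z ys"
  unfolding small_list_def by blast

lemma small_list_mono: "small_list e Z xs \<Longrightarrow> Z \<subseteq> Y \<Longrightarrow> e \<le> d \<Longrightarrow> small_list d Y xs"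
  unfolding small_list_def by (meson less_le_trans subsetD)

lemma cocycle_near_mono: "cocycle_near m f Z \<Longrightarrow> Y \<subseteq> Z \<Longrightarrow> cocycle_near m f Y"
  unfolding cocycle_near_def by (meson small_list_mono order_refl)

lemma trivial_near_mono: "trivial_near m f Z \<Longrightarrow> Y \<subseteq> Z \<Longrightarrow> trivial_near m f Y"
  unfolding trivial_near_def by (meson small_list_mono order_refl)

lemma trivial_near_diff:
  assumes "trivial_near m f Z" "trivial_near m g Z"
  shows "trivial_near m (\<lambda>xs. f xs - g xs) Z"
proof -
  obtain f' d where d: "d > 0" "\<And>xs. length xs = m \<Longrightarrow> small_list d Z xs \<Longrightarrow> f xs = cobd xs f'"
    using assms(1) unfolding trivial_near_def by metis
  obtain g' e where e: "e > 0" "\<And>xs. length xs = m \<Longrightarrow> small_list e Z xs \<Longrightarrow> g xs = cobd xs g'"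
    using assms(2) unfolding trivial_near_def by metis
  show ?thesis unfolding trivial_near_def
  proof (intro exI[of _ "\<lambda>xs. f' xs - g' xs"] exI[of _ "min d e"] conjI allI impI)
    fix xs assume xs: "length xs = m" "small_list (min d e) Z xs"
    have "small_list d Z xs" "small_list e Z xs" using xs(2) by (auto elim: small_list_mono)
    then show "f xs - g xs = cobd xs (\<lambda>xs. f' xs - g' xs)"
      using d(2) e(2) xs(1) by (simp add: cobd_diff)
  qed (use d e in auto)
qed

lemma trivial_near_zero: "trivial_near m (\<lambda>xs. 0) Z"
  unfolding trivial_near_def
  by (rule exI[of _ "\<lambda>xs. 0"], rule exI[of _ 1]) (auto simp: cobd_zero)

lemma trivial_near_add:
  assumes "trivial_near m f Z" "trivial_near m g Z"
  shows "trivial_near m (\<lambda>xs. f xs + g xs) Z"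
proof -
  have "trivial_near m (\<lambda>xs. f xs - (0 - g xs)) Z"
    by (intro trivial_near_diff assms trivial_near_zero)
  then show ?thesis by simp
qed

text \<open>The value 1 on the empty list is a cocycle near the empty set, because no one-point list
  is near it; but every coboundary vanishes on the empty list.\<close>

lemma acyclic_in_0_nonempty: "acyclic_in 0 Z \<Longrightarrow> Z \<noteq> {}"
proof
  assume a: "acyclic_in 0 Z" and "Z = {}"
  have "cocycle_near 0 (\<lambda>xs. 1) Z"
    unfolding cocycle_near_def small_list_def using \<open>Z = {}\<close> by (auto simp: length_Suc_conv intro!: exI[of _ 1])
  then have "trivial_near 0 (\<lambda>xs. 1) Z" using a unfolding acyclic_in_def by blast
  then show False unfolding trivial_near_def small_list_def by auto
qed

lemma acyclic_in_0: "Z \<noteq> {} \<Longrightarrow> acyclic_in 0 Z"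
  unfolding acyclic_in_def
proof (intro allI impI)
  fix f assume "Z \<noteq> {}" "cocycle_near 0 f Z"
  then obtain e z where e: "e > 0" "z \<in> Z"
    "\<And>xs. length xs = Suc 0 \<Longrightarrow> small_list e Z xs \<Longrightarrow> cobd xs f = 0"
    unfolding cocycle_near_def by blast
  have "small_list e Z [z]" using e(1,2) by (auto simp: small_list_def intro!: bexI[of _ z])
  then have "f [] = 0" using e(3)[of "[z]"] by simp
  then show "trivial_near 0 f Z" unfolding trivial_near_def
    by (auto intro!: exI[of _ "1::real"])
qed

section \<open>Mayer--Vietoris gluing for compact sets\<close>

text \<open>Halving the mesh pays for sending the whole list to one side: the first point is near
  one of the sets, and the other points are near the first.\<close>

lemma small_list_Un:
  assumes "small_list (e/2) (X1 \<union> X2) xs"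
  shows "small_list e X1 xs \<or> small_list e X2 xs"
proof (cases xs)
  case Nil then show ?thesis by (simp add: small_list_def)
next
  case (Cons x ys)
  then obtain z where z: "z \<in> X1 \<union> X2" "dist x z < e/2"
    using assms by (force simp: small_list_def)
  have e0: "e > 0" using z(2) zero_le_dist[of x z] by linarith
  have "dist y z < e" if "y \<in> set xs" for y
  proof -
    have "dist y x < e/2" using assms that Cons unfolding small_list_def by auto
    then show ?thesis using z(2) dist_triangle[of y z x] by linarith
  qed
  moreover have "dist y y' < e" if "y \<in> set xs" "y' \<in> set xs" for y y'
    using assms that e0 unfolding small_list_def by force
  ultimately show ?thesis using z(1) unfolding small_list_def by blast
qed

text \<open>The excision step. Points near both sets need not be equally near the intersection, but
  by compactness the part of \<open>X1\<close> away from the intersection has positive distance from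
  \<open>X2\<close>.\<close>

lemma near_Int:
  fixes X1 X2 :: "'a::heine_borel set"
  assumes "compact X1" "compact X2" "e > 0"
  obtains d where "d > 0" "d \<le> e"
    "\<And>xs. small_list d X1 xs \<Longrightarrow> small_list d X2 xs \<Longrightarrow> small_list e (X1 \<inter> X2) xs"
proof -
  define N where "N = (\<Union>z\<in>X1 \<inter> X2. ball z (e/2))"
  have "open N" unfolding N_def by auto
  then have "compact (X1 - N)" using assms(1) by (simp add: compact_diff)
  moreover have "(X1 - N) \<inter> X2 = {}" unfolding N_def using assms(3) by force
  ultimately obtain d where d: "d > 0" "\<And>x y. x \<in> X1 - N \<Longrightarrow> y \<in> X2 \<Longrightarrow> d \<le> dist x y"
    using separate_compact_closed[of "X1 - N" X2] assms(2) compact_imp_closed by blast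
  show thesis
  proof (rule that)
    fix xs assume x1: "small_list (min (d/2) (e/2)) X1 xs" and x2: "small_list (min (d/2) (e/2)) X2 xs"
    show "small_list e (X1 \<inter> X2) xs" unfolding small_list_def
    proof (intro conjI ballI)
      fix x assume x: "x \<in> set xs"
      obtain y where y: "y \<in> X1" "dist x y < d/2" "dist x y < e/2"
        using x x1 by (auto simp: small_list_def)
      obtain y' where y': "y' \<in> X2" "dist x y' < d/2"
        using x x2 by (auto simp: small_list_def)
      have "dist y y' < d" using y(2) y'(2) dist_triangle3[of y y' x] by linarith
      then have "y \<in> N" using d(2) y(1) y'(1) by force
      then obtain z where z: "z \<in> X1 \<inter> X2" "dist z y < e/2" unfolding N_def by auto
      have "dist x z < e" using y(3) z(2) dist_triangle[of x z y] by (simp add: dist_commute)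
      then show "\<exists>z\<in>X1 \<inter> X2. dist x z < e" using z(1) by blast
    next
      fix x y assume "x \<in> set xs" "y \<in> set xs"
      then have "dist x y < min (d/2) (e/2)" using x1 unfolding small_list_def by blast
      then show "dist x y < e" using assms(3) by linarith
    qed
  qed (use d assms(3) in auto)
qed

text \<open>Two primitives differ near the intersection by a cocycle, hence by a coboundary
  \<open>cobd xs h\<close>, and correcting one of them by it makes them agree there.\<close>

lemma trivial_near_Un:
  fixes X1 X2 :: "'a::heine_borel set"
  assumes "compact X1" "compact X2" and t1: "trivial_near (Suc m) f X1" and t2: "trivial_near (Suc m) f X2"
    and ac: "acyclic_in m (X1 \<inter> X2)"
  shows "trivial_near (Suc m) f (X1 \<union> X2)"
proof -
  obtain g1 e1 where e1: "e1 > 0" "\<And>xs. length xs = Suc m \<Longrightarrow> small_list e1 X1 xs \<Longrightarrow> f xs = cobd xs g1"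
    using t1 unfolding trivial_near_def by metis
  obtain g2 e2 where e2: "e2 > 0" "\<And>xs. length xs = Suc m \<Longrightarrow> small_list e2 X2 xs \<Longrightarrow> f xs = cobd xs g2"
    using t2 unfolding trivial_near_def by metis
  define e where "e = min e1 e2"
  have e: "e > 0" "e \<le> e1" "e \<le> e2" using e1 e2 by (auto simp: e_def)
  have "cocycle_near m (\<lambda>xs. g1 xs - g2 xs) (X1 \<inter> X2)" unfolding cocycle_near_def
  proof (intro exI[of _ e] conjI allI impI)
    fix xs assume xs: "length xs = Suc m" "small_list e (X1 \<inter> X2) xs"
    have "small_list e1 X1 xs" "small_list e2 X2 xs"
      using xs(2) e by (auto elim!: small_list_mono)
    then show "cobd xs (\<lambda>xs. g1 xs - g2 xs) = 0"
      using e1(2)[of xs] e2(2)[of xs] xs(1) by (simp add: cobd_diff)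
  qed (rule e)
  then have "trivial_near m (\<lambda>xs. g1 xs - g2 xs) (X1 \<inter> X2)" using ac unfolding acyclic_in_def by blast
  then obtain h e3 where e3: "e3 > 0"
    "\<And>xs. length xs = m \<Longrightarrow> small_list e3 (X1 \<inter> X2) xs \<Longrightarrow> g1 xs - g2 xs = cobd xs h"
    unfolding trivial_near_def by blast
  obtain d where d: "d > 0" "d \<le> min e e3"
    "\<And>xs. small_list d X1 xs \<Longrightarrow> small_list d X2 xs \<Longrightarrow> small_list (min e e3) (X1 \<inter> X2) xs"
    using near_Int[OF assms(1,2), of "min e e3"] e(1) e3(1) by auto
  \<comment> \<open>Since \<open>h\<close> is a function on all lists, the correction applies on the
    whole of \<open>X1\<close>. The two branches agree on lists small near both sets, so a list
    small near \<open>X2\<close> sees only \<open>g2\<close>.\<close>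
  define g where "g xs = (if small_list d X1 xs then g1 xs - cobd xs h else g2 xs)" for xs
  show ?thesis unfolding trivial_near_def
  proof (intro exI[of _ g] exI[of _ "d/2"] conjI allI impI)
    fix xs assume len: "length xs = Suc m" and sm: "small_list (d/2) (X1 \<union> X2) xs"
    consider "small_list d X1 xs" | "small_list d X2 xs"
      using small_list_Un[OF sm] by blast
    then show "f xs = cobd xs g"
    proof cases
      case 1
      have "cobd xs g = cobd xs (\<lambda>ys. g1 ys - cobd ys h)"
        by (rule cobd_cong) (use small_list_subset[OF 1] in \<open>auto simp: g_def\<close>)
      also have "\<dots> = cobd xs g1" by (simp add: cobd_diff cobd_cobd)
      also have "\<dots> = f xs" using e1(2)[OF len] 1 d(2) e(2) small_list_mono by (metis min.boundedE order_refl order_trans)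
      finally show ?thesis ..
    next
      case 2
      have "cobd xs g = cobd xs g2"
      proof (rule cobd_cong)
        fix ys assume ys: "Suc (length ys) = length xs" "set ys \<subseteq> set xs"
        have s2: "small_list d X2 ys" using small_list_subset[OF 2 ys(2)] .
        show "g ys = g2 ys"
        proof (cases "small_list d X1 ys")
          case True
          have "small_list e3 (X1 \<inter> X2) ys"
            using d(3)[OF True s2] by (rule small_list_mono) auto
          then show ?thesis using e3(2)[of ys] ys len True by (simp add: g_def)
        qed (simp add: g_def)
      qed
      also have "\<dots> = f xs" using e2(2)[OF len] 2 d(2) e(3) small_list_mono by (metis min.boundedE order_refl order_trans)
      finally show ?thesis ..
    qed
  qed (use d in auto)
qed

lemma acyclic_in_Un:
  fixes X1 X2 :: "'a::heine_borel set"
  assumes "compact X1" "compact X2" "\<And>m. acyclic_in m X1" "\<And>m. acyclic_in m X2" "\<And>m. acyclic_in m (X1 \<inter> X2)"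
  shows "acyclic_in m (X1 \<union> X2)"
proof (cases m)
  case 0
  then show ?thesis using acyclic_in_0_nonempty[OF assms(3)] by (auto intro: acyclic_in_0)
next
  case (Suc k)
  show ?thesis unfolding acyclic_in_def Suc
  proof (intro allI impI)
    fix f assume c: "cocycle_near (Suc k) f (X1 \<union> X2)"
    show "trivial_near (Suc k) f (X1 \<union> X2)"
    proof (rule trivial_near_Un[OF assms(1,2) _ _ assms(5)])
      show "trivial_near (Suc k) f X1" using assms(3) cocycle_near_mono[OF c] unfolding acyclic_in_def by blast
      show "trivial_near (Suc k) f X2" using assms(4) cocycle_near_mono[OF c] unfolding acyclic_in_def by blast
    qed
  qed
qed

section \<open>Pullback and homotopy invariance\<close>

text \<open>Uniform continuity on \<open>Z\<close> alone would not do, because the points of small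
  lists leave \<open>Z\<close>. A Lebesgue number of a cover by open sets of the ambient space
  controls them too.\<close>

lemma near_uniformly_continuous:
  fixes p :: "'a::metric_space \<Rightarrow> 'b::metric_space"
  assumes "compact Z" "continuous_on UNIV p" "e > 0"
  obtains d where "d > 0" "\<And>x y z. z \<in> Z \<Longrightarrow> dist x z < d \<Longrightarrow> dist x y < d \<Longrightarrow> dist (p x) (p y) < e"
proof -
  let ?G = "{G. open G \<and> (\<forall>x\<in>G. \<forall>y\<in>G. dist (p x) (p y) < e)}"
  have "Z \<subseteq> \<Union>?G"
  proof
    fix z assume "z \<in> Z"
    have "open (p -` ball (p z) (e/2))" by (rule open_vimage[OF open_ball assms(2)])
    moreover have "dist (p x) (p y) < e" if "x \<in> p -` ball (p z) (e/2)" "y \<in> p -` ball (p z) (e/2)" for x y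
      using that by (auto intro: dist_triangle_half_r)
    moreover have "z \<in> p -` ball (p z) (e/2)" using assms(3) by simp
    ultimately show "z \<in> \<Union>?G" by (intro UnionI[of "p -` ball (p z) (e/2)"]) blast+
  qed
  then obtain d where d: "d > 0" "\<And>z. z \<in> Z \<Longrightarrow> \<exists>G\<in>?G. ball z d \<subseteq> G"
    using Heine_Borel_lemma[OF assms(1), of ?G] by blast
  show thesis
  proof (rule that[of "d/2"])
    fix x y z assume z: "z \<in> Z" "dist x z < d/2" "dist x y < d/2"
    obtain G where G: "ball z d \<subseteq> G" "\<forall>x\<in>G. \<forall>y\<in>G. dist (p x) (p y) < e" using d(2)[OF z(1)] by blast
    have "dist z y < d" using z(2,3) dist_triangle3[of z y x] by linarith
    then have "y \<in> G" using G(1) by auto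
    moreover have "x \<in> G" using G(1) z(2) d(1) by (auto simp: dist_commute)
    ultimately show "dist (p x) (p y) < e" using G(2) by blast
  qed (use d in auto)
qed

lemma small_list_map:
  fixes p :: "'a::metric_space \<Rightarrow> 'b::metric_space"
  assumes "compact Z" "continuous_on UNIV p" "e > 0" "p ` Z \<subseteq> W"
  obtains d where "d > 0" "\<And>xs. small_list d Z xs \<Longrightarrow> small_list e W (map p xs)"
proof -
  obtain d where d: "d > 0" "\<And>x y z. z \<in> Z \<Longrightarrow> dist x z < d \<Longrightarrow> dist x y < d \<Longrightarrow> dist (p x) (p y) < e"
    using near_uniformly_continuous[OF assms(1-3)] by metis
  show thesis
  proof (rule that[OF d(1)])
    fix xs assume xs: "small_list d Z xs"
    show "small_list e W (map p xs)" unfolding small_list_def set_map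
    proof (intro conjI ballI; elim imageE)
      fix v x assume "v = p x" "x \<in> set xs"
      then obtain z where "z \<in> Z" "dist x z < d" using xs by (auto simp: small_list_def)
      then show "\<exists>w\<in>W. dist v w < e" using d(2)[of z x z] assms(4) \<open>v = p x\<close> by auto
    next
      fix v w x y assume "v = p x" "x \<in> set xs" "w = p y" "y \<in> set xs"
      then show "dist v w < e" using d(2)[of _ x y] xs unfolding small_list_def by metis
    qed
  qed
qed

lemma cocycle_near_map:
  fixes p :: "'a::metric_space \<Rightarrow> 'b::metric_space"
  assumes "compact Z" "continuous_on UNIV p" "p ` Z \<subseteq> W" "cocycle_near m f W"
  shows "cocycle_near m (\<lambda>xs. f (map p xs)) Z"
proof -
  obtain e where e: "e > 0" "\<And>xs. length xs = Suc m \<Longrightarrow> small_list e W xs \<Longrightarrow> cobd xs f = 0"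
    using assms(4) unfolding cocycle_near_def by blast
  obtain d where d: "d > 0" "\<And>xs. small_list d Z xs \<Longrightarrow> small_list e W (map p xs)"
    using small_list_map[OF assms(1,2) e(1) assms(3)] by metis
  show ?thesis unfolding cocycle_near_def using d e by (auto simp: cobd_map intro!: exI[of _ d])
qed

lemma trivial_near_map:
  fixes p :: "'a::metric_space \<Rightarrow> 'b::metric_space"
  assumes "compact Z" "continuous_on UNIV p" "p ` Z \<subseteq> W" "trivial_near m f W"
  shows "trivial_near m (\<lambda>xs. f (map p xs)) Z"
proof -
  obtain g e where e: "e > 0" "\<And>xs. length xs = m \<Longrightarrow> small_list e W xs \<Longrightarrow> f xs = cobd xs g"
    using assms(4) unfolding trivial_near_def by metis
  obtain d where d: "d > 0" "\<And>xs. small_list d Z xs \<Longrightarrow> small_list e W (map p xs)"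
    using small_list_map[OF assms(1,2) e(1) assms(3)] by metis
  show ?thesis unfolding trivial_near_def
    using d e by (auto simp: cobd_map intro!: exI[of _ "\<lambda>xs. g (map p xs)"] exI[of _ d])
qed

lemma trivial_near_prism:
  fixes p q :: "'a::metric_space \<Rightarrow> 'b::metric_space"
  assumes e: "\<And>xs. length xs = Suc m \<Longrightarrow> small_list e W xs \<Longrightarrow> cobd xs f = 0"
    and d: "d > 0" "\<And>xs. small_list d Z xs \<Longrightarrow> small_list e W (map p xs @ map q xs)"
  shows "trivial_near m (\<lambda>xs. f (map q xs) - f (map p xs)) Z"
  unfolding trivial_near_def
proof (intro exI[of _ "\<lambda>ys. prism p q ys f"] exI[of _ d] conjI allI impI)
  fix xs assume len: "length xs = m" and xs: "small_list d Z xs"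
  have "prism p q xs (\<lambda>ys. cobd ys f) = 0"
  proof (rule prism_eq_0)
    fix ys assume ys: "length ys = Suc (length xs)" "set ys \<subseteq> p ` set xs \<union> q ` set xs"
    then have "small_list e W ys" using small_list_subset[OF d(2)[OF xs], of ys] by simp
    then show "cobd ys f = 0" using e ys(1) len by simp
  qed
  then show "f (map q xs) - f (map p xs) = cobd xs (\<lambda>ys. prism p q ys f)"
    using prism_homotopy[of xs p q f] by simp
qed (rule d)

text \<open>The scale \<open>e\<close> is explicit and depends on \<open>f\<close> and
  \<open>W\<close> only, so that a homotopy can be cut into steps that all use the same
  \<open>e\<close>.\<close>

lemma trivial_near_close_maps:
  fixes p q :: "'a::metric_space \<Rightarrow> 'b::metric_space"
  assumes Z: "compact Z" and p: "continuous_on UNIV p" and q: "continuous_on UNIV q" and "p ` Z \<subseteq> W"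
    and e: "e > 0" "\<And>xs. length xs = Suc m \<Longrightarrow> small_list e W xs \<Longrightarrow> cobd xs f = 0"
    and close: "\<And>z. z \<in> Z \<Longrightarrow> dist (p z) (q z) < e/4"
  shows "trivial_near m (\<lambda>xs. f (map q xs) - f (map p xs)) Z"
proof -
  obtain d1 where d1: "d1 > 0" "\<And>x y z. z \<in> Z \<Longrightarrow> dist x z < d1 \<Longrightarrow> dist x y < d1 \<Longrightarrow> dist (p x) (p y) < e/8"
    using near_uniformly_continuous[OF Z p, of "e/8"] e(1) by auto
  obtain d2 where d2: "d2 > 0" "\<And>x y z. z \<in> Z \<Longrightarrow> dist x z < d2 \<Longrightarrow> dist x y < d2 \<Longrightarrow> dist (q x) (q y) < e/8"
    using near_uniformly_continuous[OF Z q, of "e/8"] e(1) by auto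
  define d where "d = min d1 d2"
  have d: "d > 0" "d \<le> d1" "d \<le> d2" using d1 d2 by (auto simp: d_def)
  show ?thesis
  proof (rule trivial_near_prism[OF e(2) d(1)])
    fix xs assume xs: "small_list d Z xs"
    have pp: "dist (p x) (p y) < e/8" and qq: "dist (q x) (q y) < e/8" if xy: "x \<in> set xs" "y \<in> set xs" for x y
    proof -
      obtain z where z: "z \<in> Z" "dist x z < d" using small_list_near[OF xs xy(1)] by blast
      have "dist x y < d" by (rule small_list_dist[OF xs xy])
      then show "dist (p x) (p y) < e/8" "dist (q x) (q y) < e/8"
        using d1(2)[OF z(1), of x y] d2(2)[OF z(1), of x y] z(2) d by auto
    qed
    have near: "\<exists>w\<in>W. dist (p x) w < e/8 \<and> dist (q x) w < e/2" if x: "x \<in> set xs" for x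
    proof -
      obtain z where z: "z \<in> Z" "dist x z < d" using small_list_near[OF xs x] by blast
      have "dist (p x) (p z) < e/8" "dist (q x) (q z) < e/8"
        using z d1(2)[of z x z] d2(2)[of z x z] d by auto
      moreover have "dist (q x) (p z) < e/2"
        using calculation(2) close[OF z(1)] dist_triangle2[of "q x" "p z" "q z"] e(1) by linarith
      ultimately show ?thesis using z(1) assms(4) by blast
    qed
    have pq: "dist (p x) (q y) < e" if xy: "x \<in> set xs" "y \<in> set xs" for x y
    proof -
      obtain w where "dist (p y) w < e/8" "dist (q y) w < e/2" using near[OF xy(2)] by blast
      then show ?thesis using pp[OF xy] dist_triangle[of "p x" "q y" "p y"] dist_triangle2[of "p y" "q y" w]
          e(1) by linarith
    qed
    show "small_list e W (map p xs @ map q xs)" unfolding small_list_def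
    proof (intro conjI ballI)
      fix v assume "v \<in> set (map p xs @ map q xs)"
      then obtain x where x: "x \<in> set xs" "v = p x \<or> v = q x" by auto
      obtain w where "w \<in> W" "dist (p x) w < e/8" "dist (q x) w < e/2" using near[OF x(1)] by blast
      then show "\<exists>w\<in>W. dist v w < e" using x(2) e(1) by (intro bexI[of _ w]) auto
    next
      fix v w assume "v \<in> set (map p xs @ map q xs)" "w \<in> set (map p xs @ map q xs)"
      then obtain x y where "x \<in> set xs" "v = p x \<or> v = q x" "y \<in> set xs" "w = p y \<or> w = q y" by auto
      then show "dist v w < e" using pp[of x y] qq[of x y] pq[of x y] pq[of y x] e(1) by (auto simp: dist_commute)
    qed
  qed
qed

text \<open>The homotopy is subdivided into steps that move points of \<open>Z\<close> by less than
  a quarter of the scale of the cocycle; differences over adjacent steps add up.\<close>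

lemma trivial_near_straight_homotopy:
  fixes p q :: "'a::metric_space \<Rightarrow> 'b::real_normed_vector"
  assumes Z: "compact Z" and p: "continuous_on UNIV p" and q: "continuous_on UNIV q"
    and seg: "\<And>z. z \<in> Z \<Longrightarrow> closed_segment (p z) (q z) \<subseteq> W" and c: "cocycle_near m f W"
  shows "trivial_near m (\<lambda>xs. f (map q xs) - f (map p xs)) Z"
proof -
  obtain e where e: "e > 0" "\<And>xs. length xs = Suc m \<Longrightarrow> small_list e W xs \<Longrightarrow> cobd xs f = 0"
    using c unfolding cocycle_near_def by blast
  define h where "h s z = (1 - s) *\<^sub>R p z + s *\<^sub>R q z" for s z
  have hc: "continuous_on UNIV (h s)" for s unfolding h_def by (intro continuous_intros p q)
  have "continuous_on Z (\<lambda>z. q z - p z)"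
    using p q by (intro continuous_intros) (auto intro: continuous_on_subset)
  then have "bounded ((\<lambda>z. q z - p z) ` Z)"
    using Z compact_continuous_image compact_imp_bounded by blast
  then obtain D where D: "D > 0" "\<And>z. z \<in> Z \<Longrightarrow> norm (q z - p z) \<le> D"
    unfolding bounded_pos by blast
  \<comment> \<open>The local hypothesis of the interval induction also produces intervals that
    stick out of the unit interval, where the homotopy may leave \<open>W\<close>; the guard makes
    \<open>P\<close> vacuous for them.\<close>
  define P where "P a b \<longleftrightarrow> (0 \<le> a \<and> b \<le> 1 \<longrightarrow> trivial_near m (\<lambda>xs. f (map (h b) xs) - f (map (h a) xs)) Z)" for a b
  have "P 0 1"
  proof (rule Bolzano)
    fix a b c assume "P a b" "P b c" "a \<le> b" "b \<le> c"
    then show "P a c" unfolding P_def using trivial_near_add[of m "\<lambda>xs. f (map (h b) xs) - f (map (h a) xs)" Z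
          "\<lambda>xs. f (map (h c) xs) - f (map (h b) xs)"] by auto
  next
    fix x :: real
    have "P a b" if ab: "a \<le> b" "b - a < e / (4 * D)" for a b
      unfolding P_def
    proof (intro impI trivial_near_close_maps[OF Z hc hc _ e, where W=W])
      assume "0 \<le> a \<and> b \<le> 1"
      then have "h a z \<in> closed_segment (p z) (q z)" for z
        unfolding h_def closed_segment_def using ab by auto
      then show "h a ` Z \<subseteq> W" using seg by blast
    next
      fix z assume z: "z \<in> Z"
      have "dist (h a z) (h b z) = norm ((b - a) *\<^sub>R (p z - q z))"
        unfolding dist_norm h_def by (rule arg_cong[where f=norm]) (simp add: algebra_simps)
      also have "\<dots> = (b - a) * norm (q z - p z)" using ab by (simp add: norm_minus_commute)
      also have "\<dots> \<le> (b - a) * D" using D(2)[OF z] ab by (simp add: mult_left_mono)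
      also have "\<dots> < e/4" using ab D(1) by (simp add: field_simps)
      finally show "dist (h a z) (h b z) < e/4" .
    qed auto
    then show "\<exists>d>0. \<forall>a b. a \<le> x \<and> x \<le> b \<and> b - a < d \<longrightarrow> P a b"
      using e(1) D(1) by (intro exI[of _ "e / (4 * D)"]) auto
  qed simp
  then have "trivial_near m (\<lambda>xs. f (map (h 1) xs) - f (map (h 0) xs)) Z" unfolding P_def by auto
  moreover have "h 1 = q" "h 0 = p" unfolding h_def by auto
  ultimately show ?thesis by simp
qed

text \<open>The primitive is the cone with apex \<open>v\<close>. Only constant lists occur, and
  these are small at every scale.\<close>

lemma trivial_near_const_map:
  fixes f :: "'b::metric_space list \<Rightarrow> int"
  assumes "cocycle_near m f {v}"
  shows "trivial_near m (\<lambda>xs. f (map (\<lambda>_. v) xs)) Z"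
proof -
  obtain e where e: "e > 0" "\<And>xs. length xs = Suc m \<Longrightarrow> small_list e {v} xs \<Longrightarrow> cobd xs f = 0"
    using assms unfolding cocycle_near_def by blast
  have "f (map (\<lambda>_. v) xs) = cobd xs (\<lambda>ys. f (v # map (\<lambda>_. v) ys))" if "length xs = m" for xs :: "'a list"
  proof -
    have "cobd (v # map (\<lambda>_. v) xs) f = 0"
      using that by (intro e(2)) (auto simp: small_list_def e(1))
    then show ?thesis using cobd_map[of xs "\<lambda>ys. f (v # ys)" "\<lambda>_. v"] by simp
  qed
  then show ?thesis unfolding trivial_near_def
    by (intro exI[of _ "\<lambda>ys. f (v # map (\<lambda>_. v) ys)"] exI[of _ 1]) auto
qed

section \<open>The Vietoris--Begle theorem over convex sets, and nerves\<close>

text \<open>The successor matters: the empty list is small near the empty set, so in length 0 the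
  claim fails for the constant 1.\<close>

lemma trivial_near_empty: "trivial_near (Suc m) f {}"
  unfolding trivial_near_def small_list_def by (auto simp: length_Suc_conv intro!: exI[of _ 1])

text \<open>A primitive near one level set also works near thin slabs around it, because by
  compactness the points of \<open>Y\<close> with values close to \<open>x\<close> are close to that
  level set.\<close>

lemma trivial_near_level:
  fixes q :: "'a::heine_borel \<Rightarrow> real"
  assumes Y: "compact Y" and q: "continuous_on UNIV q" and t: "trivial_near m f (Y \<inter> {z. q z = x})"
  shows "\<exists>d>0. \<forall>a c. a \<le> x \<and> x \<le> c \<and> c - a < d \<longrightarrow> trivial_near m f (Y \<inter> {z. a \<le> q z \<and> q z \<le> c})"
proof -
  obtain g e where e: "e > 0" "\<And>xs. length xs = m \<Longrightarrow> small_list e (Y \<inter> {z. q z = x}) xs \<Longrightarrow> f xs = cobd xs g"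
    using t unfolding trivial_near_def by metis
  define N where "N = (\<Union>y\<in>Y \<inter> {z. q z = x}. ball y (e/2))"
  have "open N" unfolding N_def by auto
  then have "compact (Y - N)" using Y by (simp add: compact_diff)
  then have "compact (q ` (Y - N))" using q by (meson compact_continuous_image continuous_on_subset subset_UNIV)
  then have cl: "closed (q ` (Y - N))" by (rule compact_imp_closed)
  have zN: "z \<in> N" if "z \<in> Y" "q z = x" for z
    unfolding N_def using that e(1) by (intro UN_I[of z]) auto
  then have "{x} \<inter> q ` (Y - N) = {}" by blast
  from separate_compact_closed[OF compact_sing cl this]
  obtain d where d: "d > 0" "\<forall>y\<in>{x}. \<forall>z\<in>q ` (Y - N). d \<le> dist y z" by auto
  have "trivial_near m f (Y \<inter> {z. a \<le> q z \<and> q z \<le> c})" if ac: "a \<le> x" "x \<le> c" "c - a < d" for a c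
    unfolding trivial_near_def
  proof (intro exI[of _ g] exI[of _ "e/2"] conjI allI impI)
    fix xs assume len: "length xs = m" and xs: "small_list (e/2) (Y \<inter> {z. a \<le> q z \<and> q z \<le> c}) xs"
    have "small_list e (Y \<inter> {z. q z = x}) xs" unfolding small_list_def
    proof (intro conjI ballI)
      fix v assume "v \<in> set xs"
      then obtain z where z: "z \<in> Y" "a \<le> q z" "q z \<le> c" "dist v z < e/2" using xs by (auto simp: small_list_def)
      have "dist x (q z) < d" using z(2,3) ac by (simp add: dist_real_def)
      then have "z \<in> N" using d(2) z(1) by force
      then obtain y where y: "y \<in> Y \<inter> {z. q z = x}" "dist y z < e/2" unfolding N_def by auto
      then show "\<exists>y\<in>Y \<inter> {z. q z = x}. dist v y < e"
        using z(4) dist_triangle2[of v y z] by (intro bexI[of _ y]) auto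
    next
      fix v w assume "v \<in> set xs" "w \<in> set xs"
      then have "dist v w < e/2" using xs unfolding small_list_def by blast
      then show "dist v w < e" using e(1) by linarith
    qed
    then show "f xs = cobd xs g" using e(2) len by blast
  qed (use e in auto)
  then show ?thesis using d(1) by blast
qed

text \<open>A case of the Vietoris--Begle theorem. A class of degree \<open>m + 1\<close> that is trivial over every slice of \<open>T\<close>
  by a coordinate hyperplane is trivial over thin slabs, and Mayer--Vietoris glues the slabs, because the
  slices are acyclic in degree \<open>m\<close>. Fixing the coordinates one after another reduces the slices to points.\<close>

lemma acyclic_over_convex:
  fixes p :: "'a::heine_borel \<Rightarrow> 'w::euclidean_space"
  assumes Z: "compact Z" and p: "continuous_on UNIV p"
    and "compact T" "convex T" "T \<noteq> {}" and "\<And>t m. t \<in> T \<Longrightarrow> acyclic_in m (Z \<inter> p -` {t})"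
  shows "acyclic_in m (Z \<inter> p -` T)"
  using assms(3-)
proof (induction m arbitrary: T)
  case 0
  then obtain t where "t \<in> T" by blast
  then have "Z \<inter> p -` {t} \<noteq> {}" using acyclic_in_0_nonempty 0 by blast
  then show ?case using \<open>t \<in> T\<close> by (intro acyclic_in_0) blast
next
  case (Suc m)
  have comp: "compact (Z \<inter> p -` S)" if "compact S" for S
    by (rule compact_Int_closed[OF Z closed_vimage[OF compact_imp_closed[OF that] p]])
  show ?case unfolding acyclic_in_def
  proof (intro allI impI)
    fix f assume c: "cocycle_near (Suc m) f (Z \<inter> p -` T)"
    \<comment> \<open>\<open>I\<close> holds the coordinates that may still vary on
      \<open>S\<close>. With \<open>I\<close> empty, \<open>S\<close> is at most a point; with all
      basis vectors in \<open>I\<close>, \<open>S\<close> may be \<open>T\<close> itself.\<close>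
    have claim: "trivial_near (Suc m) f (Z \<inter> p -` S)"
      if "finite I" "S \<subseteq> T" "compact S" "convex S"
        "\<And>b s t. b \<in> Basis - I \<Longrightarrow> s \<in> S \<Longrightarrow> t \<in> S \<Longrightarrow> s \<bullet> b = t \<bullet> b" for I S
      using that
    proof (induction I arbitrary: S rule: finite_induct)
      case empty
      show ?case
      proof (cases "S = {}")
        case True
        then show ?thesis by (simp add: trivial_near_empty)
      next
        case False
        then obtain s where s: "s \<in> S" by blast
        have "S = {s}"
        proof -
          have "t = s" if "t \<in> S" for t
            by (rule euclidean_eqI) (rule empty.prems(4)[OF _ that s], simp)
          then show ?thesis using s by blast
        qed
        then have "acyclic_in (Suc m) (Z \<inter> p -` S)" using Suc.prems(4) empty.prems(1) by blast
        moreover have "cocycle_near (Suc m) f (Z \<inter> p -` S)"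
          using c by (rule cocycle_near_mono) (use empty.prems(1) in auto)
        ultimately show ?thesis unfolding acyclic_in_def by blast
      qed
    next
      case (insert j I)
      define P where "P u v \<longleftrightarrow> trivial_near (Suc m) f (Z \<inter> p -` (S \<inter> {t. u \<le> t \<bullet> j \<and> t \<bullet> j \<le> v}))" for u v
      obtain a where a: "\<And>s. s \<in> S \<Longrightarrow> norm (s \<bullet> j) \<le> a" "a > 0"
      proof -
        have "bounded ((\<lambda>s. s \<bullet> j) ` S)"
          by (intro compact_imp_bounded compact_continuous_image continuous_intros insert.prems)
        then show thesis using that unfolding bounded_pos by (metis image_eqI)
      qed
      have slab: "compact (S \<inter> {t. u \<le> t \<bullet> j \<and> t \<bullet> j \<le> v})" for u v
        by (intro compact_Int_closed insert.prems closed_Collect_conj closed_Collect_le continuous_intros)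
      have hyper: "compact (S \<inter> {t. t \<bullet> j = v})" "convex (S \<inter> {t. t \<bullet> j = v})" for v
        using insert.prems(2,3) convex_hyperplane[of j v] closed_hyperplane[of j v]
        by (auto simp: inner_commute intro!: convex_Int compact_Int_closed)
      have "P (-a) a"
      proof (rule Bolzano)
        fix u v w assume P: "P u v" "P v w" and uvw: "u \<le> v" "v \<le> w"
        let ?X1 = "Z \<inter> p -` (S \<inter> {t. u \<le> t \<bullet> j \<and> t \<bullet> j \<le> v})"
        let ?X2 = "Z \<inter> p -` (S \<inter> {t. v \<le> t \<bullet> j \<and> t \<bullet> j \<le> w})"
        let ?X = "Z \<inter> p -` (S \<inter> {t. u \<le> t \<bullet> j \<and> t \<bullet> j \<le> w})"
        have X: "?X = ?X1 \<union> ?X2" using uvw by auto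
        show "P u w"
        \<comment> \<open>If the dividing hyperplane meets \<open>S\<close>, the slice is convex and
          the outer induction makes its preimage acyclic in degree index \<open>m\<close>, as gluing
          requires. If it misses \<open>S\<close>, connectedness puts \<open>S\<close> on one side
          and nothing is glued.\<close>
        proof (cases "S \<inter> {t. t \<bullet> j = v} = {}")
          case False
          have "acyclic_in m (Z \<inter> p -` (S \<inter> {t. t \<bullet> j = v}))"
            by (rule Suc.IH[OF hyper False]) (use Suc.prems(4) insert.prems(1) in auto)
          moreover have "?X1 \<inter> ?X2 = Z \<inter> p -` (S \<inter> {t. t \<bullet> j = v})" using uvw by auto
          ultimately show ?thesis using P unfolding P_def X
            by (intro trivial_near_Un comp slab) auto
        next
          case True
          have "\<not> (s \<bullet> j \<le> v \<and> v \<le> t \<bullet> j)" if "s \<in> S" "t \<in> S" for s t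
            using connected_ivt_hyperplane[OF convex_connected[OF insert.prems(3)] that, of j v] True
            by (auto simp: inner_commute)
          then have "?X1 = {} \<or> ?X2 = {}" by auto
          then show ?thesis using P X unfolding P_def by force
        qed
      next
        fix x
        have "trivial_near (Suc m) f (Z \<inter> p -` (S \<inter> {t. t \<bullet> j = x}))"
        proof (rule insert.IH)
          fix b s t assume "b \<in> Basis - I" "s \<in> S \<inter> {t. t \<bullet> j = x}" "t \<in> S \<inter> {t. t \<bullet> j = x}"
          then show "s \<bullet> b = t \<bullet> b" using insert.prems(4)[of b s t] by (cases "b = j") auto
        qed (use insert.prems(1) hyper in auto)
        then have "trivial_near (Suc m) f ((Z \<inter> p -` S) \<inter> {z. p z \<bullet> j = x})"
          by (rule trivial_near_mono) auto
        then have "\<exists>d>0. \<forall>a c. a \<le> x \<and> x \<le> c \<and> c - a < d \<longrightarrow>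
            trivial_near (Suc m) f ((Z \<inter> p -` S) \<inter> {z. a \<le> p z \<bullet> j \<and> p z \<bullet> j \<le> c})"
          by (intro trivial_near_level comp insert.prems continuous_intros p)
        moreover have "(Z \<inter> p -` S) \<inter> {z. a \<le> p z \<bullet> j \<and> p z \<bullet> j \<le> c} =
            Z \<inter> p -` (S \<inter> {t. a \<le> t \<bullet> j \<and> t \<bullet> j \<le> c})" for a c by auto
        ultimately show "\<exists>d>0. \<forall>a c. a \<le> x \<and> x \<le> c \<and> c - a < d \<longrightarrow> P a c"
          unfolding P_def by simp
      qed (use a in auto)
      then show ?case unfolding P_def by (rule trivial_near_mono) (use a in \<open>force simp: abs_le_iff\<close>)
    qed
    show "trivial_near (Suc m) f (Z \<inter> p -` T)"
      by (rule claim[of Basis]) (use Suc.prems in auto)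
  qed
qed

section \<open>Covers with acyclic intersections\<close>

text \<open>Mayer--Vietoris adds one set at a time. The induction is applied also to the traces on
  the new set \<open>Z j\<close>, whose intersections over \<open>J\<close> are intersections over
  \<open>insert j J\<close>.\<close>

lemma acyclic_in_UN:
  fixes Z :: "'i \<Rightarrow> 'a::heine_borel set"
  assumes "finite I" "I \<noteq> {}" "\<And>i. i \<in> I \<Longrightarrow> compact (Z i)"
    "\<And>J m. J \<subseteq> I \<Longrightarrow> J \<noteq> {} \<Longrightarrow> acyclic_in m (\<Inter>i\<in>J. Z i)"
  shows "acyclic_in m (\<Union>i\<in>I. Z i)"
  using assms
proof (induction I arbitrary: Z m rule: finite_ne_induct)
  case (singleton i)
  then show ?case using singleton(2)[of "{i}"] by simp
next
  case (insert j I)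
  have "acyclic_in m ((\<Union>i\<in>I. Z i) \<union> Z j)"
  proof (rule acyclic_in_Un)
    show "compact (\<Union>i\<in>I. Z i)" "compact (Z j)" using insert by auto
    show "acyclic_in m (\<Union>i\<in>I. Z i)" for m
    proof (rule insert.IH)
      fix J m assume "J \<subseteq> I" "J \<noteq> {}"
      then show "acyclic_in m (\<Inter>i\<in>J. Z i)" by (intro insert.prems(2)) auto
    qed (use insert.prems(1) in auto)
    show "acyclic_in m (Z j)" for m using insert.prems(2)[of "{j}"] by simp
    have "acyclic_in m (\<Union>i\<in>I. Z i \<inter> Z j)" for m
    proof (rule insert.IH)
      fix J m assume J: "J \<subseteq> I" "J \<noteq> {}"
      then have "(\<Inter>i\<in>J. Z i \<inter> Z j) = (\<Inter>i\<in>insert j J. Z i)" by auto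
      then show "acyclic_in m (\<Inter>i\<in>J. Z i \<inter> Z j)" using insert.prems(2)[of "insert j J"] J by (metis insert_mono insert_not_empty)
    qed (use insert.prems in auto)
    then show "acyclic_in m ((\<Union>i\<in>I. Z i) \<inter> Z j)" for m by (simp add: Int_UN_distrib2)
  qed
  then show ?case by (simp add: Un_commute)
qed

text \<open>The class lives on the union of the \<open>K i\<close> and is obtained from the unit cocycle of the empty
  intersection by iterated Mayer--Vietoris connecting homomorphisms. It depends on \<open>K\<close> only, so that it can
  be pulled back along homotopic maps.\<close>

lemma nerve_class:
  fixes K :: "'i \<Rightarrow> 'b::heine_borel set"
  assumes "finite I" "I \<noteq> {}" "\<And>i. i \<in> I \<Longrightarrow> compact (K i)" "(\<Inter>i\<in>I. K i) = {}"
  shows "\<exists>w. cocycle_near (card I - 1) w (\<Union>i\<in>I. K i) \<and>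
    (\<forall>(Z :: 'i \<Rightarrow> 'a::heine_borel set) p. continuous_on UNIV p \<longrightarrow> (\<forall>i\<in>I. compact (Z i) \<and> p ` Z i \<subseteq> K i) \<longrightarrow>
      (\<forall>J m. J \<subset> I \<longrightarrow> J \<noteq> {} \<longrightarrow> acyclic_in m (\<Inter>i\<in>J. Z i)) \<longrightarrow>
      \<not> trivial_near (card I - 1) (\<lambda>xs. w (map p xs)) (\<Union>i\<in>I. Z i))"
  using assms
proof (induction I arbitrary: K rule: finite_ne_induct)
  case (singleton i)
  then have "K i = {}" by simp
  then show ?case
    \<comment> \<open>A single index forces \<open>K i\<close> and hence \<open>Z i\<close> to be
      empty, and the unit on the empty list is then a nontrivial cocycle.\<close>
    by (intro exI[of _ "\<lambda>_. 1"])
      (auto simp: cocycle_near_def trivial_near_def small_list_def length_Suc_conv intro!: exI[of _ "1::real"])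
next
  case (insert j I)
  define m where "m = card I - 1"
  have cI: "card (insert j I) - 1 = Suc m" using insert by (auto simp: m_def card_gt_0_iff)
  let ?U = "\<Union>i\<in>I. K i"
  have "(\<Inter>i\<in>I. K i \<inter> K j) = {}" using insert.prems(2) insert.hyps(2) by auto
  then obtain w' where w': "cocycle_near m w' (\<Union>i\<in>I. K i \<inter> K j)"
    "\<And>(Z :: 'i \<Rightarrow> 'a set) p. continuous_on UNIV p \<Longrightarrow> \<forall>i\<in>I. compact (Z i) \<and> p ` Z i \<subseteq> K i \<inter> K j \<Longrightarrow>
      \<forall>J m. J \<subset> I \<longrightarrow> J \<noteq> {} \<longrightarrow> acyclic_in m (\<Inter>i\<in>J. Z i) \<Longrightarrow>
      \<not> trivial_near m (\<lambda>xs. w' (map p xs)) (\<Union>i\<in>I. Z i)"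
    using insert.IH[of "\<lambda>i. K i \<inter> K j"] insert.prems(1) unfolding m_def[symmetric] by (auto simp: compact_Int)
  obtain e where e: "e > 0" "\<And>xs. length xs = Suc m \<Longrightarrow> small_list e (?U \<inter> K j) xs \<Longrightarrow> cobd xs w' = 0"
    using w'(1) unfolding cocycle_near_def by (auto simp: Int_UN_distrib2)
  have U: "compact ?U" "compact (K j)" using insert by auto
  obtain d where d: "d > 0"
    "\<And>xs. small_list d ?U xs \<Longrightarrow> small_list d (K j) xs \<Longrightarrow> small_list e (?U \<inter> K j) xs"
    using near_Int[OF U e(1)] by metis
  \<comment> \<open>The connecting homomorphism: the class \<open>w'\<close> of the intersection
    becomes a coboundary on the side of \<open>K j\<close> and zero on the other side. Both agree
    near the overlap since \<open>w'\<close> is a cocycle there.\<close>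
  define w where "w xs = (if small_list d (K j) xs then cobd xs w' else 0)" for xs
  have w0: "w xs = 0" if "length xs = Suc m" "small_list d ?U xs" for xs
    using that d(2) e(2) unfolding w_def by auto
  have "cocycle_near (Suc m) w (?U \<union> K j)" unfolding cocycle_near_def
  proof (intro exI[of _ "d/2"] conjI allI impI)
    fix xs assume len: "length xs = Suc (Suc m)" and sm: "small_list (d/2) (?U \<union> K j) xs"
    consider "small_list d ?U xs" | "small_list d (K j) xs" using small_list_Un[OF sm] by blast
    then show "cobd xs w = 0"
    proof cases
      case 1
      have "cobd xs w = cobd xs (\<lambda>_. 0)"
        by (rule cobd_cong, rule w0) (use len small_list_subset[OF 1] in auto)
      then show ?thesis by (simp add: cobd_zero)
    next
      case 2
      have "cobd xs w = cobd xs (\<lambda>ys. cobd ys w')"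
        by (rule cobd_cong) (use small_list_subset[OF 2] in \<open>auto simp: w_def\<close>)
      then show ?thesis by (simp add: cobd_cobd)
    qed
  qed (use d in auto)
  moreover have "\<not> trivial_near (Suc m) (\<lambda>xs. w (map p xs)) (\<Union>i\<in>insert j I. Z i)"
    if p: "continuous_on UNIV p" and Z: "\<forall>i\<in>insert j I. compact (Z i) \<and> p ` Z i \<subseteq> K i"
      and ac: "\<forall>J m. J \<subset> insert j I \<longrightarrow> J \<noteq> {} \<longrightarrow> acyclic_in m (\<Inter>i\<in>J. Z i)"
    for Z :: "'i \<Rightarrow> 'a set" and p
  proof
    let ?V = "\<Union>i\<in>I. Z i"
    assume "trivial_near (Suc m) (\<lambda>xs. w (map p xs)) (\<Union>i\<in>insert j I. Z i)"
    then obtain g e0 where g: "e0 > 0" "\<And>xs. length xs = Suc m \<Longrightarrow> small_list e0 (\<Union>i\<in>insert j I. Z i) xs \<Longrightarrow>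
        w (map p xs) = cobd xs g"
      unfolding trivial_near_def by metis
    have cV: "compact ?V" "p ` ?V \<subseteq> ?U" and cj: "compact (Z j)" "p ` Z j \<subseteq> K j"
      using Z insert.hyps(1) by (auto, blast)
    obtain d1 where d1: "d1 > 0" "\<And>xs. small_list d1 ?V xs \<Longrightarrow> small_list d ?U (map p xs)"
      using small_list_map[OF cV(1) p d(1) cV(2)] by metis
    obtain d2 where d2: "d2 > 0" "\<And>xs. small_list d2 (Z j) xs \<Longrightarrow> small_list d (K j) (map p xs)"
      using small_list_map[OF cj(1) p d(1) cj(2)] by metis
    \<comment> \<open>A primitive \<open>g\<close> of the pulled back class splits \<open>w'\<close>
      on the overlap as \<open>g + (w' - g)\<close>. The first summand is a cocycle near
      \<open>?V\<close>, where \<open>w\<close> vanishes; the second is one near \<open>Z j\<close>,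
      where \<open>w\<close> is the coboundary of \<open>w'\<close>. Acyclicity of both pieces would
      make \<open>w'\<close> trivial, against the induction hypothesis.\<close>
    have "cocycle_near m g ?V" unfolding cocycle_near_def
    proof (intro exI[of _ "min d1 e0"] conjI allI impI)
      fix xs assume xs: "length xs = Suc m" "small_list (min d1 e0) ?V xs"
      have "small_list d1 ?V xs" "small_list e0 (\<Union>i\<in>insert j I. Z i) xs"
        using xs(2) by (auto elim!: small_list_mono)
      then show "cobd xs g = 0" using g(2)[of xs] w0[of "map p xs"] d1(2) xs(1) by simp
    qed (use d1 g in auto)
    moreover have "acyclic_in m ?V"
    proof (rule acyclic_in_UN)
      fix J m assume "J \<subseteq> I" "J \<noteq> {}"
      then show "acyclic_in m (\<Inter>i\<in>J. Z i)" using insert.hyps(3) by (intro ac[rule_format]) auto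
    qed (use insert.hyps Z in auto)
    ultimately have t1: "trivial_near m g ?V" unfolding acyclic_in_def by blast
    have "cocycle_near m (\<lambda>xs. w' (map p xs) - g xs) (Z j)" unfolding cocycle_near_def
    proof (intro exI[of _ "min d2 e0"] conjI allI impI)
      fix xs assume xs: "length xs = Suc m" "small_list (min d2 e0) (Z j) xs"
      have "small_list d2 (Z j) xs" "small_list e0 (\<Union>i\<in>insert j I. Z i) xs"
        using xs(2) by (auto elim!: small_list_mono)
      then show "cobd xs (\<lambda>xs. w' (map p xs) - g xs) = 0"
        using g(2)[of xs] d2(2) xs(1) by (simp add: cobd_diff cobd_map w_def)
    qed (use d2 g in auto)
    moreover have "acyclic_in m (Z j)" using ac[rule_format, of "{j}" m] insert.hyps by auto
    ultimately have t2: "trivial_near m (\<lambda>xs. w' (map p xs) - g xs) (Z j)" unfolding acyclic_in_def by blast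
    have "trivial_near m (\<lambda>xs. g xs + (w' (map p xs) - g xs)) (?V \<inter> Z j)"
      by (intro trivial_near_add trivial_near_mono[OF t1] trivial_near_mono[OF t2]) auto
    then have "trivial_near m (\<lambda>xs. w' (map p xs)) (\<Union>i\<in>I. Z i \<inter> Z j)" by (simp add: Int_UN_distrib2)
    moreover have "\<not> trivial_near m (\<lambda>xs. w' (map p xs)) (\<Union>i\<in>I. Z i \<inter> Z j)"
    proof (rule w'(2)[OF p])
      show "\<forall>i\<in>I. compact (Z i \<inter> Z j) \<and> p ` (Z i \<inter> Z j) \<subseteq> K i \<inter> K j" using Z by (auto intro!: compact_Int)
      show "\<forall>J m. J \<subset> I \<longrightarrow> J \<noteq> {} \<longrightarrow> acyclic_in m (\<Inter>i\<in>J. Z i \<inter> Z j)"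
      proof (intro allI impI)
        fix J m assume J: "J \<subset> I" "J \<noteq> {}"
        then have "(\<Inter>i\<in>J. Z i \<inter> Z j) = (\<Inter>i\<in>insert j J. Z i)" by auto
        moreover have "insert j J \<subset> insert j I" using J insert.hyps(3) by auto
        then have "acyclic_in m (\<Inter>i\<in>insert j J. Z i)" by (rule ac[rule_format]) simp
        ultimately show "acyclic_in m (\<Inter>i\<in>J. Z i \<inter> Z j)" by simp
      qed
    qed
    ultimately show False by blast
  qed
  moreover have "(\<Union>i\<in>insert j I. K i) = ?U \<union> K j" by auto
  ultimately show ?case unfolding cI by (intro exI[of _ w]) auto
qed

section \<open>Comparison with \v{C}ech cohomology\<close>

lemma cobd_eq_sum: "cobd xs f = (\<Sum>i<length xs. (-1) ^ i * f (take i xs @ drop (Suc i) xs))"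
  by (induction xs arbitrary: f) (auto simp: sum.lessThan_Suc_shift sum_negf simp del: sum.lessThan_Suc)

text \<open>With the point \<open>x\<close> fixed, the Cech differential is \<open>cobd\<close> on
  lists of members of the cover, so the list calculus serves both theories.\<close>

lemma cech_coboundary_eq:
  "cech_coboundary k U c us x =
    (if us \<in> lists U \<and> length us = Suc (Suc k) \<and> x \<in> \<Inter>(set us) then cobd us (\<lambda>vs. c vs x) else 0)"
  unfolding cech_coboundary_def cobd_eq_sum by (auto simp: lessThan_Suc_atMost)

lemma continuous_map_int_iff:
  "continuous_map X (discrete_topology UNIV) (f :: 'a \<Rightarrow> int) \<longleftrightarrow>
    (\<forall>x\<in>topspace X. \<exists>N. openin X N \<and> x \<in> N \<and> (\<forall>y\<in>N. f y = f x))" (is "?L \<longleftrightarrow> ?R")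
proof
  assume L: ?L
  show ?R
  proof
    fix x assume x: "x \<in> topspace X"
    have "openin X {y \<in> topspace X. f y \<in> {f x}}"
      by (rule openin_continuous_map_preimage[OF L]) simp
    moreover have "x \<in> {y \<in> topspace X. f y \<in> {f x}}" "\<forall>y\<in>{y \<in> topspace X. f y \<in> {f x}}. f y = f x"
      using x by auto
    ultimately show "\<exists>N. openin X N \<and> x \<in> N \<and> (\<forall>y\<in>N. f y = f x)" by blast
  qed
next
  assume R: ?R
  have "openin X {y \<in> topspace X. f y \<in> T}" for T
  proof (subst openin_subopen, intro ballI)
    fix x assume "x \<in> {y \<in> topspace X. f y \<in> T}"
    then have x: "x \<in> topspace X" "f x \<in> T" by auto
    obtain N where N: "openin X N" "x \<in> N" "\<forall>y\<in>N. f y = f x" using R x(1) by blast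
    have "y \<in> topspace X \<and> f y \<in> T" if "y \<in> N" for y
      using that N(3) x(2) openin_subset[OF N(1)] by (metis subsetD)
    then have "N \<subseteq> {y \<in> topspace X. f y \<in> T}" by blast
    then show "\<exists>N. openin X N \<and> x \<in> N \<and> N \<subseteq> {y \<in> topspace X. f y \<in> T}" using N by blast
  qed
  then show ?L unfolding continuous_map_def by auto
qed

lemma continuous_map_int_add:
  fixes f g :: "'a \<Rightarrow> int"
  assumes "continuous_map X (discrete_topology UNIV) f" "continuous_map X (discrete_topology UNIV) g"
  shows "continuous_map X (discrete_topology UNIV) (\<lambda>x. f x + g x)"
  unfolding continuous_map_int_iff
proof
  fix x assume x: "x \<in> topspace X"
  obtain M where M: "openin X M" "x \<in> M" "\<forall>y\<in>M. f y = f x"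
    using assms(1) x unfolding continuous_map_int_iff by blast
  obtain N where N: "openin X N" "x \<in> N" "\<forall>y\<in>N. g y = g x"
    using assms(2) x unfolding continuous_map_int_iff by blast
  show "\<exists>N. openin X N \<and> x \<in> N \<and> (\<forall>y\<in>N. f y + g y = f x + g x)"
    using openin_Int[OF M(1) N(1)] M(2,3) N(2,3) by (metis IntD1 IntD2 IntI)
qed

lemma refinement_projection:
  assumes "refined_by \<U> \<V>" "V \<in> \<V>"
  shows "refinement_projection \<U> V \<in> \<U>" "V \<subseteq> refinement_projection \<U> V"
proof -
  have "\<exists>U. U \<in> \<U> \<and> V \<subseteq> U" using assms unfolding refined_by_def by blast
  then show "refinement_projection \<U> V \<in> \<U>" "V \<subseteq> refinement_projection \<U> V"
    using someI_ex unfolding refinement_projection_def by (metis (no_types, lifting))+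
qed

lemma cech_cochains_add:
  assumes "c \<in> cech_cochains k X \<U>" "d \<in> cech_cochains k X \<U>"
  shows "(\<lambda>us x. c us x + d us x) \<in> cech_cochains k X \<U>"
  using assms unfolding cech_cochains_def by (auto intro!: continuous_map_int_add)

lemma cech_coboundary_add:
  "cech_coboundary k \<U> (\<lambda>us x. c us x + d us x) = (\<lambda>us x. cech_coboundary k \<U> c us x + cech_coboundary k \<U> d us x)"
  by (intro ext) (simp add: cech_coboundary_eq cobd_add)

lemma map_refinement_projection:
  assumes "refined_by \<U> \<V>" "vs \<in> lists \<V>"
  shows "map (refinement_projection \<U>) vs \<in> lists \<U>"
    "\<Inter>(set vs) \<subseteq> \<Inter>(set (map (refinement_projection \<U>) vs))"
  using assms refinement_projection[OF assms(1)] by (simp add: in_lists_conv_set)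
    (use assms(2) refinement_projection(2)[OF assms(1)] in \<open>force simp: in_lists_conv_set\<close>)

lemma cech_pullback_cochain:
  assumes r: "refined_by \<U> \<V>" and c: "c \<in> cech_cochains k X \<U>"
  shows "cech_pullback \<V> (refinement_projection \<U>) c \<in> cech_cochains k X \<V>"
proof -
  let ?t = "refinement_projection \<U>"
  have "continuous_map (subtopology X (\<Inter>(set vs))) (discrete_topology UNIV) (cech_pullback \<V> ?t c vs)"
    if vs: "vs \<in> lists \<V>" "length vs = Suc k" for vs
  proof -
    have "map ?t vs \<in> lists \<U>" "length (map ?t vs) = Suc k"
      using map_refinement_projection(1)[OF r vs(1)] vs(2) by simp_all
    then have "continuous_map (subtopology X (\<Inter>(set (map ?t vs)))) (discrete_topology UNIV) (c (map ?t vs))"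
      using c unfolding cech_cochains_def by blast
    then have "continuous_map (subtopology X (\<Inter>(set vs))) (discrete_topology UNIV) (c (map ?t vs))"
      using map_refinement_projection(2)[OF r vs(1)] continuous_map_from_subtopology_mono by blast
    then show ?thesis
      by (rule continuous_map_eq) (use vs in \<open>auto simp: cech_pullback_def\<close>)
  qed
  moreover have "cech_pullback \<V> ?t c vs x = 0" if "\<not> (vs \<in> lists \<V> \<and> length vs = Suc k \<and> x \<in> \<Inter>(set vs))" for vs x
    using that c unfolding cech_cochains_def cech_pullback_def by auto
  ultimately show ?thesis unfolding cech_cochains_def by blast
qed

lemma cech_pullback_coboundary:
  assumes r: "refined_by \<U> \<V>"
  shows "cech_pullback \<V> (refinement_projection \<U>) (cech_coboundary k \<U> c) =
    cech_coboundary k \<V> (cech_pullback \<V> (refinement_projection \<U>) c)"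
proof (intro ext)
  fix vs x
  let ?t = "refinement_projection \<U>"
  show "cech_pullback \<V> ?t (cech_coboundary k \<U> c) vs x = cech_coboundary k \<V> (cech_pullback \<V> ?t c) vs x"
  proof (cases "vs \<in> lists \<V> \<and> length vs = Suc (Suc k) \<and> x \<in> \<Inter>(set vs)")
    case True
    have "cobd vs (\<lambda>ws. cech_pullback \<V> ?t c ws x) = cobd vs (\<lambda>ws. c (map ?t ws) x)"
      by (rule cobd_cong) (use True in \<open>auto simp: cech_pullback_def in_lists_conv_set\<close>)
    also have "\<dots> = cobd (map ?t vs) (\<lambda>us. c us x)" by (rule cobd_map)
    finally show ?thesis using True map_refinement_projection[OF r, of vs]
      by (auto simp: cech_coboundary_eq cech_pullback_def)
  next
    case False
    then show ?thesis by (auto simp: cech_coboundary_eq cech_pullback_def)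
  qed
qed

lemma cech_cochains_zero: "(\<lambda>us x. 0) \<in> cech_cochains k X \<U>"
  unfolding cech_cochains_def by auto

lemma cech_coboundary_zero: "cech_coboundary k \<U> (\<lambda>us x. 0) = (\<lambda>us x. 0)"
  by (intro ext) (simp add: cech_coboundary_eq cobd_zero)

lemma carrier_cech_cover_group:
  "carrier (cech_cover_group k X \<U>) =
    (\<lambda>c. cech_coboundaries k X \<U> #>\<^bsub>cech_cocycle_group k X \<U>\<^esub> c) ` carrier (cech_cocycle_group k X \<U>)"
  unfolding cech_cover_group_def FactGroup_def RCOSETS_def by auto

lemma r_coset_cech_cocycle_group:
  "H #>\<^bsub>cech_cocycle_group k X \<U>\<^esub> c = (\<lambda>h us x. h us x + c us x) ` H"
  unfolding r_coset_def cech_cocycle_group_def by auto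

lemma zero_in_cech_coboundaries: "(\<lambda>us x. 0) \<in> cech_coboundaries k X \<U>"
proof (cases k)
  case (Suc l)
  then show ?thesis
    using imageI[OF cech_cochains_zero[of l X \<U>], of "cech_coboundary l \<U>"]
    by (simp add: cech_coboundaries_def cech_coboundary_zero)
qed (simp add: cech_coboundaries_def)

lemma in_direct_limit_class:
  fixes G :: "'i \<Rightarrow> 'g monoid"
  assumes "i \<in> I" "x \<in> carrier (G i)" "prec i i"
  shows "(i, x) \<in> direct_limit_rel I prec G \<rho> `` {(i, x)}"
    "direct_limit_rel I prec G \<rho> `` {(i, x)} \<in> carrier (direct_limit I prec G \<rho>)"
proof -
  show "(i, x) \<in> direct_limit_rel I prec G \<rho> `` {(i, x)}"
    using assms unfolding direct_limit_rel_def by auto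
  have "(i, x) \<in> (SIGMA i:I. carrier (G i))" using assms by blast
  then show "direct_limit_rel I prec G \<rho> `` {(i, x)} \<in> carrier (direct_limit I prec G \<rho>)"
    unfolding direct_limit_def by (simp add: quotientI)
qed

section \<open>Degree zero: locally constant functions\<close>

text \<open>The global function glued from a 0-cocycle. The choice of the member around
  \<open>x\<close> is immaterial because the cocycle condition on a pair of members says that their
  values agree.\<close>

definition cech_section :: "'a set set \<Rightarrow> ('a set list \<Rightarrow> 'a \<Rightarrow> int) \<Rightarrow> 'a \<Rightarrow> int" where
  "cech_section \<U> c x = c [SOME U. U \<in> \<U> \<and> x \<in> U] x"

lemma cech_section_eq:
  assumes c: "c \<in> carrier (cech_cocycle_group 0 X \<U>)" and "U \<in> \<U>" "x \<in> U"
  shows "c [U] x = cech_section \<U> c x"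
proof -
  define V where "V = (SOME U. U \<in> \<U> \<and> x \<in> U)"
  have V: "V \<in> \<U>" "x \<in> V" using someI_ex[of "\<lambda>U. U \<in> \<U> \<and> x \<in> U"] assms(2,3) unfolding V_def by blast+
  have "cech_coboundary 0 \<U> c [V, U] x = 0" using c unfolding cech_cocycle_group_def by simp
  then show ?thesis using V assms(2,3) unfolding cech_section_def V_def[symmetric] by (simp add: cech_coboundary_eq)
qed

lemma carrier_cech_cover_group_0:
  "carrier (cech_cover_group 0 X \<U>) = (\<lambda>c. {c}) ` carrier (cech_cocycle_group 0 X \<U>)"
  unfolding carrier_cech_cover_group r_coset_cech_cocycle_group by (simp add: cech_coboundaries_def)

lemma cech_refinement_map_0:
  "cech_refinement_map 0 X \<U> \<V> {c} = {cech_pullback \<V> (refinement_projection \<U>) c}"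
  unfolding cech_refinement_map_def r_coset_cech_cocycle_group by (simp add: cech_coboundaries_def)

lemma mult_cech_cover_group_0: "{c} \<otimes>\<^bsub>cech_cover_group 0 X \<U>\<^esub> {d} = {\<lambda>us x. c us x + d us x}"
  unfolding cech_cover_group_def FactGroup_def set_mult_def cech_cocycle_group_def by simp

lemma cech_cocycle_add:
  assumes "c \<in> carrier (cech_cocycle_group k X \<U>)" "d \<in> carrier (cech_cocycle_group k X \<U>)"
  shows "(\<lambda>us x. c us x + d us x) \<in> carrier (cech_cocycle_group k X \<U>)"
  using assms by (simp add: cech_cocycle_group_def cech_cochains_add cech_coboundary_add)

text \<open>In degree 0 the limit forgets everything but the glued function. Equal functions become
  equal cochains on the cover by pairwise intersections.\<close>

lemma direct_limit_rel_cech_0_iff: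
  assumes U: "\<U> \<in> open_covers X" and c: "c \<in> carrier (cech_cocycle_group 0 X \<U>)"
    and V: "\<V> \<in> open_covers X" and d: "d \<in> carrier (cech_cocycle_group 0 X \<V>)"
  shows "((\<U>, {c}), (\<V>, {d})) \<in>
      direct_limit_rel (open_covers X) refined_by (cech_cover_group 0 X) (cech_refinement_map 0 X) \<longleftrightarrow>
    (\<forall>x\<in>topspace X. cech_section \<U> c x = cech_section \<V> d x)" (is "?L \<longleftrightarrow> ?R")
proof
  assume ?L
  then obtain \<W> where W: "\<W> \<in> open_covers X" "refined_by \<U> \<W>" "refined_by \<V> \<W>"
    "cech_pullback \<W> (refinement_projection \<U>) c = cech_pullback \<W> (refinement_projection \<V>) d"
    unfolding direct_limit_rel_def by (auto simp: cech_refinement_map_0)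
  show ?R
  proof
    fix x assume "x \<in> topspace X"
    then obtain N where N: "N \<in> \<W>" "x \<in> N" using W(1) unfolding open_covers_def by blast
    have "c [refinement_projection \<U> N] x = d [refinement_projection \<V> N] x"
      using fun_cong[OF fun_cong[OF W(4), of "[N]"], of x] N by (simp add: cech_pullback_def)
    moreover have "c [refinement_projection \<U> N] x = cech_section \<U> c x"
      using refinement_projection[OF W(2) N(1)] N(2) by (intro cech_section_eq[OF c]) auto
    moreover have "d [refinement_projection \<V> N] x = cech_section \<V> d x"
      using refinement_projection[OF W(3) N(1)] N(2) by (intro cech_section_eq[OF d]) auto
    ultimately show "cech_section \<U> c x = cech_section \<V> d x" by simp
  qed
next
  assume R: ?R
  define \<W> where "\<W> = {M \<inter> N | M N. M \<in> \<U> \<and> N \<in> \<V>}"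
  have W: "\<W> \<in> open_covers X"
  proof -
    have "\<Union>\<W> = \<Union>\<U> \<inter> \<Union>\<V>" unfolding \<W>_def by blast
    moreover have "openin X W" if "W \<in> \<W>" for W
      using that U V unfolding \<W>_def open_covers_def by auto
    ultimately show ?thesis using U V unfolding open_covers_def by auto
  qed
  have r: "refined_by \<U> \<W>" "refined_by \<V> \<W>" unfolding refined_by_def \<W>_def by blast+
  have "cech_pullback \<W> (refinement_projection \<U>) c = cech_pullback \<W> (refinement_projection \<V>) d"
  proof (intro ext)
    fix ws x
    show "cech_pullback \<W> (refinement_projection \<U>) c ws x = cech_pullback \<W> (refinement_projection \<V>) d ws x"
    proof (cases "length ws = Suc 0 \<and> ws \<in> lists \<W> \<and> x \<in> \<Inter>(set ws)")
      case True
      then obtain N where N: "ws = [N]" "N \<in> \<W>" "x \<in> N" by (auto simp: length_Suc_conv)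
      have "c [refinement_projection \<U> N] x = cech_section \<U> c x"
        using refinement_projection[OF r(1) N(2)] N(3) by (intro cech_section_eq[OF c]) auto
      moreover have "d [refinement_projection \<V> N] x = cech_section \<V> d x"
        using refinement_projection[OF r(2) N(2)] N(3) by (intro cech_section_eq[OF d]) auto
      moreover have "x \<in> topspace X" using N W unfolding open_covers_def by blast
      ultimately show ?thesis using R N by (simp add: cech_pullback_def)
    next
      case False
      then show ?thesis using c d unfolding cech_cocycle_group_def cech_cochains_def cech_pullback_def by auto
    qed
  qed
  then show ?L using W r U V c d unfolding direct_limit_rel_def
    by (auto simp: cech_refinement_map_0 carrier_cech_cover_group_0)
qed

text \<open>An element of the direct limit described without a chosen representative: all cocycles
  on all covers that glue to \<open>\<phi>\<close>. Cosets are singletons because the only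
  coboundary in degree 0 is zero.\<close>

definition cech_class_0 :: "'a topology \<Rightarrow> ('a \<Rightarrow> int) \<Rightarrow> ('a set set \<times> ('a set list \<Rightarrow> 'a \<Rightarrow> int) set) set" where
  "cech_class_0 X \<phi> = {(\<U>, {c}) | \<U> c. \<U> \<in> open_covers X \<and> c \<in> carrier (cech_cocycle_group 0 X \<U>) \<and>
    (\<forall>x\<in>topspace X. cech_section \<U> c x = \<phi> x)}"

lemma cech_class_0_eq_Image:
  fixes X :: "'a topology"
  assumes "\<U> \<in> open_covers X" "c \<in> carrier (cech_cocycle_group 0 X \<U>)"
    "\<And>x. x \<in> topspace X \<Longrightarrow> cech_section \<U> c x = \<phi> x"
  shows "cech_class_0 X \<phi> = direct_limit_rel (open_covers X) refined_by (cech_cover_group 0 X)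
    (cech_refinement_map 0 X) `` {(\<U>, {c})}" (is "_ = ?R `` _")
proof (rule Set.set_eqI)
  fix P :: "'a set set \<times> ('a set list \<Rightarrow> 'a \<Rightarrow> int) set"
  obtain \<V> h where P: "P = (\<V>, h)" by force
  show "P \<in> cech_class_0 X \<phi> \<longleftrightarrow> P \<in> ?R `` {(\<U>, {c})}"
  proof
    assume "P \<in> cech_class_0 X \<phi>"
    then show "P \<in> ?R `` {(\<U>, {c})}" unfolding cech_class_0_def
      using direct_limit_rel_cech_0_iff[OF assms(1,2)] assms(3) by auto
  next
    assume R: "P \<in> ?R `` {(\<U>, {c})}"
    then have "\<V> \<in> open_covers X" "h \<in> carrier (cech_cover_group 0 X \<V>)"
      unfolding direct_limit_rel_def P by auto
    then obtain d where d: "\<V> \<in> open_covers X" "d \<in> carrier (cech_cocycle_group 0 X \<V>)" "h = {d}"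
      unfolding carrier_cech_cover_group_0 by blast
    then show "P \<in> cech_class_0 X \<phi>"
      using R direct_limit_rel_cech_0_iff[OF assms(1,2) d(1,2)] assms(3) unfolding cech_class_0_def P by auto
  qed
qed

lemma topspace_cover: "{topspace X} \<in> open_covers X"
  unfolding open_covers_def by simp

text \<open>The cover with the whole space as its only member already carries every locally constant
  function.\<close>

lemma cech_class_0_witness:
  fixes \<phi> :: "'a \<Rightarrow> int"
  assumes "continuous_map X (discrete_topology UNIV) \<phi>"
  obtains c where "c \<in> carrier (cech_cocycle_group 0 X {topspace X})"
    "\<And>x. x \<in> topspace X \<Longrightarrow> cech_section {topspace X} c x = \<phi> x"
proof -
  let ?U = "{topspace X}"
  define c where "c us x = (if us \<in> lists ?U \<and> length us = Suc 0 \<and> x \<in> \<Inter>(set us) then \<phi> x else 0)" for us x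
  have "continuous_map (subtopology X (\<Inter>(set us))) (discrete_topology UNIV) (c us)"
    if us: "us \<in> lists ?U" "length us = Suc 0" for us
    by (rule continuous_map_eq[OF continuous_map_from_subtopology[OF assms]]) (use us in \<open>auto simp: c_def\<close>)
  then have "c \<in> cech_cochains 0 X ?U" unfolding cech_cochains_def by (auto simp: c_def)
  moreover have "cech_coboundary 0 ?U c = (\<lambda>us x. 0)"
    by (intro ext) (auto simp: cech_coboundary_eq length_Suc_conv c_def)
  ultimately have c: "c \<in> carrier (cech_cocycle_group 0 X ?U)" unfolding cech_cocycle_group_def by simp
  show thesis
  proof (rule that[OF c])
    fix x assume "x \<in> topspace X"
    then show "cech_section ?U c x = \<phi> x" using cech_section_eq[OF c, of "topspace X" x] by (simp add: c_def)
  qed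
qed

lemma cech_class_0_carrier:
  assumes "continuous_map X (discrete_topology UNIV) \<phi>"
  shows "cech_class_0 X \<phi> \<in> carrier (cech_cohomology 0 X)"
proof -
  obtain c where w: "c \<in> carrier (cech_cocycle_group 0 X {topspace X})"
    "\<And>x. x \<in> topspace X \<Longrightarrow> cech_section {topspace X} c x = \<phi> x" using cech_class_0_witness[OF assms] by metis
  have "refined_by {topspace X} {topspace X}" unfolding refined_by_def by blast
  then have "direct_limit_rel (open_covers X) refined_by (cech_cover_group 0 X) (cech_refinement_map 0 X) ``
      {({topspace X}, {c})} \<in> carrier (cech_cohomology 0 X)"
    unfolding cech_cohomology_def using w(1) topspace_cover
    by (intro in_direct_limit_class(2)) (auto simp: carrier_cech_cover_group_0)
  moreover have "cech_class_0 X \<phi> = direct_limit_rel (open_covers X) refined_by (cech_cover_group 0 X)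
      (cech_refinement_map 0 X) `` {({topspace X}, {c})}"
    by (rule cech_class_0_eq_Image[OF topspace_cover w])
  ultimately show ?thesis by simp
qed

lemma cech_class_0_inj:
  assumes "continuous_map X (discrete_topology UNIV) \<phi>" "cech_class_0 X \<phi> = cech_class_0 X \<psi>" "x \<in> topspace X"
  shows "\<phi> x = \<psi> x"
proof -
  obtain c where w: "c \<in> carrier (cech_cocycle_group 0 X {topspace X})"
    "\<And>x. x \<in> topspace X \<Longrightarrow> cech_section {topspace X} c x = \<phi> x" using cech_class_0_witness[OF assms(1)] by metis
  then have "({topspace X}, {c}) \<in> cech_class_0 X \<phi>"
    using topspace_cover unfolding cech_class_0_def by blast
  then have "({topspace X}, {c}) \<in> cech_class_0 X \<psi>" using assms(2) by simp
  then show ?thesis using w(2) assms(3) unfolding cech_class_0_def by auto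
qed

lemma cech_class_0_mult:
  assumes "continuous_map X (discrete_topology UNIV) \<phi>" "continuous_map X (discrete_topology UNIV) \<psi>"
  shows "cech_class_0 X \<phi> \<otimes>\<^bsub>cech_cohomology 0 X\<^esub> cech_class_0 X \<psi> = cech_class_0 X (\<lambda>x. \<phi> x + \<psi> x)"
proof -
  let ?R = "direct_limit_rel (open_covers X) refined_by (cech_cover_group 0 X) (cech_refinement_map 0 X)"
  let ?M = "{(\<U>, h \<otimes>\<^bsub>cech_cover_group 0 X \<U>\<^esub> g) | \<U> h g.
    (\<U>, h) \<in> cech_class_0 X \<phi> \<and> (\<U>, g) \<in> cech_class_0 X \<psi>}"
  have sum: "?R `` {P} = cech_class_0 X (\<lambda>x. \<phi> x + \<psi> x)" if P: "P \<in> ?M" for P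
  proof -
    obtain \<U> h g where hg: "P = (\<U>, h \<otimes>\<^bsub>cech_cover_group 0 X \<U>\<^esub> g)"
      "(\<U>, h) \<in> cech_class_0 X \<phi>" "(\<U>, g) \<in> cech_class_0 X \<psi>" using P by blast
    obtain c where c: "h = {c}" "\<U> \<in> open_covers X" "c \<in> carrier (cech_cocycle_group 0 X \<U>)"
      "\<And>x. x \<in> topspace X \<Longrightarrow> cech_section \<U> c x = \<phi> x" using hg(2) unfolding cech_class_0_def by blast
    obtain d where d: "g = {d}" "d \<in> carrier (cech_cocycle_group 0 X \<U>)"
      "\<And>x. x \<in> topspace X \<Longrightarrow> cech_section \<U> d x = \<psi> x" using hg(3) unfolding cech_class_0_def by blast
    have "cech_class_0 X (\<lambda>x. \<phi> x + \<psi> x) = ?R `` {(\<U>, {\<lambda>us x. c us x + d us x})}"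
      by (rule cech_class_0_eq_Image[OF c(2) cech_cocycle_add[OF c(3) d(2)]])
        (use c(4) d(3) in \<open>auto simp: cech_section_def\<close>)
    then show ?thesis unfolding hg(1) c(1) d(1) mult_cech_cover_group_0 by simp
  qed
  \<comment> \<open>The product in the limit is a union over all pairs of representatives at a
    common cover. All of them give the same class, but without one such pair the union would be
    empty.\<close>
  have "?M \<noteq> {}"
  proof -
    obtain c where c: "c \<in> carrier (cech_cocycle_group 0 X {topspace X})"
      "\<And>x. x \<in> topspace X \<Longrightarrow> cech_section {topspace X} c x = \<phi> x"
      using cech_class_0_witness[OF assms(1)] by metis
    obtain d where d: "d \<in> carrier (cech_cocycle_group 0 X {topspace X})"
      "\<And>x. x \<in> topspace X \<Longrightarrow> cech_section {topspace X} d x = \<psi> x"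
      using cech_class_0_witness[OF assms(2)] by metis
    have "({topspace X}, {c}) \<in> cech_class_0 X \<phi>" "({topspace X}, {d}) \<in> cech_class_0 X \<psi>"
      using c d topspace_cover unfolding cech_class_0_def by blast+
    then show ?thesis by blast
  qed
  then have "?R `` ?M = cech_class_0 X (\<lambda>x. \<phi> x + \<psi> x)" using sum by blast
  then show ?thesis unfolding cech_cohomology_def direct_limit_def by simp
qed

text \<open>A group embedded in the integers has rank at most one, so \<open>\<phi>\<close> and the
  constant 1 are dependent: the functions \<open>H \<phi>\<close> and \<open>H 1 * \<phi>\<close>
  have the same image and coincide, where \<open>H 1\<close> is nonzero as the space has a
  point.\<close>

lemma cech_cohomology_0_const:
  fixes \<phi> :: "'a \<Rightarrow> int"
  assumes iso: "cech_cohomology 0 X \<cong> integer_group"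
    and \<phi>: "continuous_map X (discrete_topology UNIV) \<phi>" and xy: "x \<in> topspace X" "y \<in> topspace X"
  shows "\<phi> x = \<phi> y"
proof -
  let ?C = "\<lambda>\<psi>. continuous_map X (discrete_topology UNIV) (\<psi> :: 'a \<Rightarrow> int)"
  obtain h where h: "h \<in> hom (cech_cohomology 0 X) integer_group"
    "inj_on h (carrier (cech_cohomology 0 X))"
    using iso unfolding is_iso_def iso_def bij_betw_def by auto
  define H where "H \<psi> = h (cech_class_0 X \<psi>)" for \<psi>
  have add: "H (\<lambda>x. \<psi> x + \<xi> x) = H \<psi> + H \<xi>" if "?C \<psi>" "?C \<xi>" for \<psi> \<xi>
    using hom_mult[OF h(1) cech_class_0_carrier[OF that(1)] cech_class_0_carrier[OF that(2)]] that
    by (simp add: H_def cech_class_0_mult)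
  have inj: "\<psi> z = \<xi> z" if "?C \<psi>" "?C \<xi>" "H \<psi> = H \<xi>" "z \<in> topspace X" for \<psi> \<xi> z
    using inj_onD[OF h(2) that(3)[unfolded H_def]] that cech_class_0_carrier cech_class_0_inj by metis
  have mul: "?C (\<lambda>x. a * \<psi> x)" if "?C \<psi>" for a \<psi>
    using that unfolding continuous_map_int_iff by (metis)
  have const: "?C (\<lambda>x. a)" for a by simp
  have scale: "H (\<lambda>x. a * \<psi> x) = a * H \<psi>" if \<psi>: "?C \<psi>" for a \<psi>
  proof -
    have step: "H (\<lambda>x. (a + 1) * \<psi> x) = H (\<lambda>x. a * \<psi> x) + H \<psi>" for a
      using add[OF mul[OF \<psi>, of a] \<psi>] by (simp add: algebra_simps)
    have zero: "H (\<lambda>x. 0 * \<psi> x) = 0" using add[OF const[of 0] const[of 0]] by simp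
    show ?thesis
    proof (induction a rule: int_induct[where k=0])
      case base then show ?case using zero by simp
    next
      case (step1 i) then show ?case using step[of i] by (simp add: algebra_simps)
    next
      case (step2 i) then show ?case using step[of "i - 1"] by (simp add: algebra_simps)
    qed
  qed
  have one: "H (\<lambda>x. a) = a * H (\<lambda>x. 1)" for a using scale[OF const[of 1], of a] by simp
  have nz: "H (\<lambda>x. 1) \<noteq> 0"
  proof
    assume "H (\<lambda>x. 1) = 0"
    then have "H (\<lambda>x. 1) = H (\<lambda>x. 0)" using one[of 0] by simp
    then show False using inj[OF const const] xy(1) by force
  qed
  have "H (\<lambda>x. H \<phi>) = H (\<lambda>x. H (\<lambda>x. 1) * \<phi> x)"
    using one[of "H \<phi>"] scale[OF \<phi>] by simp
  then have "H \<phi> = H (\<lambda>x. 1) * \<phi> z" if "z \<in> topspace X" for z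
    using inj[OF const mul[OF \<phi>] _ that] by blast
  then have "H (\<lambda>x. 1) * \<phi> x = H (\<lambda>x. 1) * \<phi> y" using xy by metis
  then show ?thesis using nz by simp
qed

section \<open>Positive degrees\<close>

text \<open>Being the unit of the limit means agreeing, on a common refinement, with the image of
  the unit coset of some other cover \<open>i\<close>. That coset consists of coboundaries, and
  pullback keeps them coboundaries.\<close>

lemma trivial_cech_cohomology_witness:
  assumes triv: "trivial_group (cech_cohomology (Suc k) X)" and U: "\<U> \<in> open_covers X"
    and c: "c \<in> carrier (cech_cocycle_group (Suc k) X \<U>)"
  obtains \<V> b where "\<V> \<in> open_covers X" "refined_by \<U> \<V>" "b \<in> cech_cochains k X \<V>"
    "cech_pullback \<V> (refinement_projection \<U>) c = cech_coboundary k \<V> b"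
proof -
  let ?G = "cech_cover_group (Suc k) X" and ?r = "cech_refinement_map (Suc k) X"
  let ?R = "direct_limit_rel (open_covers X) refined_by ?G ?r"
  let ?H = "\<lambda>\<U>. cech_coboundaries (Suc k) X \<U>"
  define h where "h = ?H \<U> #>\<^bsub>cech_cocycle_group (Suc k) X \<U>\<^esub> c"
  have h: "h \<in> carrier (?G \<U>)" unfolding h_def carrier_cech_cover_group using c by blast
  have ch: "c \<in> h" unfolding h_def r_coset_cech_cocycle_group
    by (rule image_eqI[OF _ zero_in_cech_coboundaries]) simp
  have refl: "refined_by \<U> \<U>" unfolding refined_by_def by blast
  have "?R `` {(\<U>, h)} \<in> carrier (cech_cohomology (Suc k) X)"
    unfolding cech_cohomology_def by (rule in_direct_limit_class(2)[where prec=refined_by and G="?G", OF U h refl])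
  then have "?R `` {(\<U>, h)} = \<one>\<^bsub>cech_cohomology (Suc k) X\<^esub>"
    using triv unfolding trivial_group_def by (elim conjE) simp
  then have "?R `` {(\<U>, h)} = ?R `` {(i, \<one>\<^bsub>?G i\<^esub>) | i. i \<in> open_covers X}"
    unfolding cech_cohomology_def direct_limit_def by simp
  moreover have "(\<U>, h) \<in> ?R `` {(\<U>, h)}" by (rule in_direct_limit_class(1)[where prec=refined_by and G="?G", OF U h refl])
  ultimately obtain i where "((i, \<one>\<^bsub>?G i\<^esub>), (\<U>, h)) \<in> ?R" by auto
  then obtain \<V> where V: "\<V> \<in> open_covers X" "refined_by i \<V>" "refined_by \<U> \<V>"
    "?r i \<V> \<one>\<^bsub>?G i\<^esub> = ?r \<U> \<V> h"
    unfolding direct_limit_rel_def by blast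
  have one: "\<one>\<^bsub>?G i\<^esub> = ?H i" unfolding cech_cover_group_def FactGroup_def by simp
  have "cech_pullback \<V> (refinement_projection \<U>) c \<in> ?r \<U> \<V> h"
    unfolding cech_refinement_map_def r_coset_cech_cocycle_group
    by (rule UN_I[OF ch], rule image_eqI[OF _ zero_in_cech_coboundaries]) simp
  then have "cech_pullback \<V> (refinement_projection \<U>) c \<in> ?r i \<V> (?H i)" using V(4) one by simp
  then obtain e1 e2 where e: "e1 \<in> cech_cochains k X \<V>" "e2 \<in> cech_cochains k X i"
    "cech_pullback \<V> (refinement_projection \<U>) c =
      (\<lambda>us x. cech_coboundary k \<V> e1 us x +
        cech_pullback \<V> (refinement_projection i) (cech_coboundary k i e2) us x)"
    unfolding cech_refinement_map_def r_coset_cech_cocycle_group cech_coboundaries_def by auto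
  show thesis
  proof (rule that[OF V(1,3)])
    show "(\<lambda>us x. e1 us x + cech_pullback \<V> (refinement_projection i) e2 us x) \<in> cech_cochains k X \<V>"
      by (intro cech_cochains_add e cech_pullback_cochain V)
  qed (simp add: e(3) cech_coboundary_add cech_pullback_coboundary[OF V(2)])
qed

text \<open>Selecting a point in each member of a cover of small mesh turns an Alexander--Spanier cocycle into a
  \v{C}ech cocycle. A \v{C}ech primitive on a refinement is turned back by selecting, for each point, a member
  of the refinement around it. The composite moves every point only a little, so the prism operator
  compares it with the original cocycle.\<close>

lemma acyclic_in_of_trivial_cech:
  fixes S :: "'a::heine_borel set"
  assumes S: "compact S" and triv: "trivial_group (cech_cohomology (Suc k) (top_of_set S))"
  shows "acyclic_in (Suc (Suc k)) S"
  unfolding acyclic_in_def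
proof (intro allI impI)
  let ?m = "Suc (Suc k)" and ?X = "top_of_set S"
  fix f assume "cocycle_near ?m f S"
  then obtain e where e: "e > 0" "\<And>xs. length xs = Suc ?m \<Longrightarrow> small_list e S xs \<Longrightarrow> cobd xs f = 0"
    unfolding cocycle_near_def by blast
  \<comment> \<open>Members have diameter at most \<open>e/4\<close>, so chosen points of members
    with a common point form a list of mesh below \<open>e\<close>.\<close>
  define \<U> where "\<U> = (\<lambda>z. S \<inter> ball z (e/8)) ` S"
  have U: "\<U> \<in> open_covers ?X" unfolding open_covers_def \<U>_def using e(1) by (auto intro: openin_open_Int)
  define pt where "pt U = (SOME x. x \<in> U)" for U :: "'a set"
  have pt: "pt U \<in> U" "pt U \<in> S" "\<And>x. x \<in> U \<Longrightarrow> dist (pt U) x < e/4" if U: "U \<in> \<U>" for U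
  proof -
    obtain z where z: "z \<in> S" "U = S \<inter> ball z (e/8)" using U unfolding \<U>_def by blast
    then have "z \<in> U" using e(1) by simp
    then show *: "pt U \<in> U" unfolding pt_def by (rule someI)
    then show "pt U \<in> S" using z by blast
    show "dist (pt U) x < e/4" if "x \<in> U" for x
      using that * z(2) dist_triangle3[of "pt U" x z] by auto
  qed
  define c where "c us x = (if us \<in> lists \<U> \<and> length us = ?m \<and> x \<in> \<Inter>(set us) then f (map pt us) else 0)"
    for us and x :: 'a
  have "continuous_map (subtopology ?X (\<Inter>(set us))) (discrete_topology UNIV) (c us)"
    if us: "us \<in> lists \<U>" "length us = ?m" for us
    by (rule continuous_map_eq[of _ _ "\<lambda>_. f (map pt us)"]) (use us in \<open>auto simp: c_def\<close>)
  then have "c \<in> cech_cochains (Suc k) ?X \<U>" unfolding cech_cochains_def by (auto simp: c_def)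
  moreover have "cech_coboundary (Suc k) \<U> c = (\<lambda>us x. 0)"
  proof (intro ext)
    fix us and x :: 'a
    show "cech_coboundary (Suc k) \<U> c us x = 0"
    proof (cases "us \<in> lists \<U> \<and> length us = Suc ?m \<and> x \<in> \<Inter>(set us)")
      case True
      have near: "pt U \<in> S" "dist (pt U) x < e/4" if "U \<in> set us" for U
        using that True pt[of U] by (auto simp: in_lists_conv_set)
      have "cobd us (\<lambda>vs. c vs x) = cobd us (\<lambda>vs. f (map pt vs))"
        by (rule cobd_cong) (use True in \<open>auto simp: c_def in_lists_conv_set\<close>)
      also have "\<dots> = cobd (map pt us) f" by (rule cobd_map)
      also have "\<dots> = 0"
      proof (rule e(2))
        have "dist (pt U) (pt V) < e" if "U \<in> set us" "V \<in> set us" for U V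
          using near(2)[OF that(1)] near(2)[OF that(2)] dist_triangle2[of "pt U" "pt V" x] e(1) by linarith
        then show "small_list e S (map pt us)" using near(1) e(1) unfolding small_list_def by force
      qed (use True in auto)
      finally show ?thesis by (simp add: cech_coboundary_eq)
    qed (auto simp: cech_coboundary_eq)
  qed
  ultimately have "c \<in> carrier (cech_cocycle_group (Suc k) ?X \<U>)" unfolding cech_cocycle_group_def by simp
  then obtain \<V> b where V: "\<V> \<in> open_covers ?X" "refined_by \<U> \<V>" and b: "b \<in> cech_cochains k ?X \<V>"
    and cb: "cech_pullback \<V> (refinement_projection \<U>) c = cech_coboundary k \<V> b"
    using trivial_cech_cohomology_witness[OF triv U] by metis
  let ?\<tau> = "refinement_projection \<U>"
  let ?O = "{N. open N \<and> S \<inter> N \<in> \<V>}"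
  have "S \<subseteq> \<Union>?O"
  proof
    fix x assume "x \<in> S"
    then obtain N where N: "N \<in> \<V>" "x \<in> N" using V(1) unfolding open_covers_def by auto
    then have "openin ?X N" using V(1) unfolding open_covers_def by blast
    then obtain M where "open M" "N = S \<inter> M" by (auto simp: openin_open)
    then show "x \<in> \<Union>?O" using N by auto
  qed
  then obtain r where r: "r > 0" "\<And>x. x \<in> S \<Longrightarrow> \<exists>G\<in>?O. ball x r \<subseteq> G"
    using Heine_Borel_lemma[OF S, of ?O] by blast
  \<comment> \<open>A finite net ensures that only finitely many members of the refinement are ever
    selected. Then just finitely many functions \<open>b vs\<close> matter, and each point has one
    radius on which those defined there are constant.\<close>
  obtain F where F: "finite F" "F \<subseteq> S" "S \<subseteq> (\<Union>x\<in>F. ball x (r/2))"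
    using seq_compact_imp_totally_bounded[OF compact_imp_seq_compact[OF S]] r(1) by (meson half_gt_zero)
  have "\<forall>x\<in>S. \<exists>N. N \<in> \<V> \<and> S \<inter> ball x r \<subseteq> N" using r(2) by blast
  then obtain w where w: "\<And>x. x \<in> S \<Longrightarrow> w x \<in> \<V> \<and> S \<inter> ball x r \<subseteq> w x" by metis
  have "\<forall>x\<in>S. \<exists>z. z \<in> F \<and> dist z x < r/2" using F(3) by (auto simp: subset_eq)
  then obtain ctr where ctr: "\<And>x. x \<in> S \<Longrightarrow> ctr x \<in> F \<and> dist (ctr x) x < r/2" by metis
  have wF: "w ` F \<subseteq> \<V>" using w F(2) by blast
  define v where "v x = w (ctr x)" for x
  have v: "v x \<in> w ` F" "v x \<in> \<V>" "S \<inter> ball x (r/2) \<subseteq> v x" if x: "x \<in> S" for x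
  proof -
    have c: "ctr x \<in> F" "dist (ctr x) x < r/2" "ctr x \<in> S" using ctr[OF x] F(2) by auto
    have "ball x (r/2) \<subseteq> ball (ctr x) r"
    proof
      fix y assume "y \<in> ball x (r/2)"
      then show "y \<in> ball (ctr x) r" using c(2) dist_triangle[of "ctr x" y x] by auto
    qed
    then show "v x \<in> w ` F" "v x \<in> \<V>" "S \<inter> ball x (r/2) \<subseteq> v x" using c w[of "ctr x"] unfolding v_def by auto
  qed
  define L where "L = {vs. set vs \<subseteq> w ` F \<and> length vs = Suc k}"
  have finL: "finite L" unfolding L_def using F(1) by (intro finite_lists_length_eq) auto
  let ?N = "\<lambda>x \<rho>. 0 < \<rho> \<and> \<rho> \<le> r/2 \<and> (\<forall>vs\<in>L. x \<in> \<Inter>(set vs) \<longrightarrow> (\<forall>y\<in>S \<inter> ball x \<rho>. b vs y = b vs x))"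
  define O2 where "O2 = {ball x \<rho> | x \<rho>. x \<in> S \<and> ?N x \<rho>}"
  have cov: "S \<subseteq> \<Union>O2"
  proof
    fix x assume x: "x \<in> S"
    have "\<forall>vs\<in>L. \<exists>d>0. x \<in> \<Inter>(set vs) \<longrightarrow> (\<forall>y\<in>S \<inter> ball x d. b vs y = b vs x)"
    proof
      fix vs assume vs: "vs \<in> L"
      show "\<exists>d>0. x \<in> \<Inter>(set vs) \<longrightarrow> (\<forall>y\<in>S \<inter> ball x d. b vs y = b vs x)"
      proof (cases "x \<in> \<Inter>(set vs)")
        case True
        have lists: "vs \<in> lists \<V>" "set vs \<noteq> {}" "length vs = Suc k"
          using vs wF unfolding L_def by (auto simp: in_lists_conv_set)
        have xt: "x \<in> topspace (subtopology ?X (\<Inter>(set vs)))" using True x by simp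
        have "continuous_map (subtopology ?X (\<Inter>(set vs))) (discrete_topology UNIV) (b vs)"
          using lists b unfolding cech_cochains_def by blast
        then obtain N where N: "openin (subtopology ?X (\<Inter>(set vs))) N" "x \<in> N" "\<forall>y\<in>N. b vs y = b vs x"
          unfolding continuous_map_int_iff using xt by blast
        have "openin ?X (\<Inter>(set vs))"
          using lists V(1) unfolding open_covers_def by (intro openin_Inter) (auto simp: in_lists_conv_set)
        then have "openin ?X N" using N(1) openin_trans_full by blast
        then obtain d where "d > 0" "ball x d \<inter> S \<subseteq> N" using N(2) unfolding openin_contains_ball by blast
        then show ?thesis using N(3) by (intro exI[of _ d]) auto
      qed (auto intro: exI[of _ 1])
    qed
    then obtain d where d: "\<And>vs. vs \<in> L \<Longrightarrow> d vs > 0"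
      "\<And>vs y. vs \<in> L \<Longrightarrow> x \<in> \<Inter>(set vs) \<Longrightarrow> y \<in> S \<inter> ball x (d vs) \<Longrightarrow> b vs y = b vs x" by metis
    define \<rho> where "\<rho> = Min (insert (r/2) (d ` L))"
    have "\<rho> > 0" unfolding \<rho>_def using finL d(1) r(1) by auto
    have "\<rho> \<le> r/2" unfolding \<rho>_def by (rule Min_le) (use finL in auto)
    have le: "\<rho> \<le> d vs" if "vs \<in> L" for vs
      unfolding \<rho>_def by (rule Min_le) (use finL that in auto)
    have bx: "b vs y = b vs x" if "vs \<in> L" "x \<in> \<Inter>(set vs)" "y \<in> S \<inter> ball x \<rho>" for vs y
      using that(3) le[OF that(1)] by (intro d(2) that(1,2)) auto
    have "?N x \<rho>"
      by (intro conjI ballI impI \<open>\<rho> > 0\<close> \<open>\<rho> \<le> r/2\<close>) (rule bx)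
    then have "\<exists>x' \<rho>'. ball x \<rho> = ball x' \<rho>' \<and> x' \<in> S \<and> ?N x' \<rho>'"
      by (intro exI[of _ x] exI[of _ \<rho>] conjI[OF refl] conjI[OF x])
    then have "ball x \<rho> \<in> O2" unfolding O2_def by (rule CollectI)
    then show "x \<in> \<Union>O2" using \<open>\<rho> > 0\<close> by (intro UnionI[of "ball x \<rho>"]) auto
  qed
  have op: "\<And>G. G \<in> O2 \<Longrightarrow> open G" unfolding O2_def by auto
  obtain \<mu> where mu: "\<mu> > 0" "\<And>x. x \<in> S \<Longrightarrow> \<exists>G\<in>O2. ball x \<mu> \<subseteq> G"
    using Heine_Borel_lemma[OF S cov op] by blast
  \<comment> \<open>The first bound keeps the prism lists below the scale \<open>e\<close>. The
    second counts three moves of less than \<open>s\<close>: from a projected point back to the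
    list, along the list, and to another projected point.\<close>
  define s where "s = min (e/16) (\<mu>/3)"
  have s: "s > 0" "s \<le> e/16" "3 * s \<le> \<mu>" using e(1) mu(1) by (auto simp: s_def)
  \<comment> \<open>Lists may leave \<open>S\<close>, but cover members and the sections
    \<open>b vs\<close> live on \<open>S\<close>; so every point is first moved into
    \<open>S\<close>.\<close>
  define \<pi> where "\<pi> x = (SOME z. z \<in> S \<and> dist x z < s)" for x
  have pi: "\<pi> x \<in> S \<and> dist x (\<pi> x) < s" if "small_list s S xs" "x \<in> set xs" for x xs
    unfolding \<pi>_def by (rule someI_ex) (use small_list_near[OF that] in blast)
  define h where "h x = pt (?\<tau> (v (\<pi> x)))" for x
  \<comment> \<open>A Cech cochain needs a point of evaluation, taken here from the head of each
    face. The head varies with the face, but all projected points lie in one ball on which the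
    relevant \<open>b vs\<close> have their value at its centre \<open>x0\<close>, so one common
    point can be used.\<close>
  have fh: "f (map h xs) = cobd xs (\<lambda>ys. b (map (\<lambda>x. v (\<pi> x)) ys) (\<pi> (hd ys)))"
    if len: "length xs = ?m" and xs: "small_list s S xs" for xs
  proof -
    have "hd xs \<in> set xs" using len by (cases xs) auto
    then obtain G where "G \<in> O2" "ball (\<pi> (hd xs)) \<mu> \<subseteq> G" using mu(2) pi[OF xs] by blast
    then obtain x0 \<rho> where x0: "x0 \<in> S" "?N x0 \<rho>" "ball (\<pi> (hd xs)) \<mu> \<subseteq> ball x0 \<rho>" unfolding O2_def by blast
    have in_ball: "\<pi> x \<in> ball x0 \<rho>" if x: "x \<in> set xs" for x
    proof -
      have "dist (hd xs) x < s" using small_list_dist[OF xs \<open>hd xs \<in> set xs\<close> x] .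
      then have "dist (\<pi> (hd xs)) (\<pi> x) < 3 * s"
        using pi[OF xs x] pi[OF xs \<open>hd xs \<in> set xs\<close>] dist_triangle3[of "\<pi> (hd xs)" "\<pi> x" "hd xs"]
          dist_triangle[of "hd xs" "\<pi> x" x] by linarith
      then have "\<pi> x \<in> ball (\<pi> (hd xs)) \<mu>" using s(3) by simp
      then show ?thesis using x0(3) by blast
    qed
    have x0v: "x0 \<in> v (\<pi> x)" if x: "x \<in> set xs" for x
    proof -
      have "x0 \<in> S \<inter> ball (\<pi> x) (r/2)" using in_ball[OF x] x0 by (auto simp: dist_commute)
      then show ?thesis using v(3) pi[OF xs x] by blast
    qed
    let ?vs = "map (\<lambda>x. v (\<pi> x)) xs"
    have vs: "?vs \<in> lists \<V>" using v(2) pi[OF xs] by (auto simp: in_lists_conv_set)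
    have "cobd xs (\<lambda>ys. b (map (\<lambda>x. v (\<pi> x)) ys) (\<pi> (hd ys))) = cobd xs (\<lambda>ys. b (map (\<lambda>x. v (\<pi> x)) ys) x0)"
    proof (rule cobd_cong)
      fix ys assume ys: "Suc (length ys) = length xs" "set ys \<subseteq> set xs"
      have "hd ys \<in> set xs" using ys len by (cases ys) auto
      then have "\<pi> (hd ys) \<in> S \<inter> ball x0 \<rho>" using in_ball pi[OF xs] by blast
      moreover have "map (\<lambda>x. v (\<pi> x)) ys \<in> L"
        using ys len v(1) pi[OF xs] unfolding L_def by auto
      moreover have "x0 \<in> \<Inter>(set (map (\<lambda>x. v (\<pi> x)) ys))" using x0v ys(2) by auto
      ultimately show "b (map (\<lambda>x. v (\<pi> x)) ys) (\<pi> (hd ys)) = b (map (\<lambda>x. v (\<pi> x)) ys) x0"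
        using x0(2) by blast
    qed
    also have "\<dots> = cobd ?vs (\<lambda>us. b us x0)" by (rule cobd_map)
    also have "\<dots> = cech_coboundary k \<V> b ?vs x0" using vs x0v len by (auto simp: cech_coboundary_eq)
    also have "\<dots> = c (map ?\<tau> ?vs) x0" unfolding cb[symmetric] cech_pullback_def using vs x0v by auto
    also have "\<dots> = f (map h xs)"
    proof -
      have "x0 \<in> \<Inter>(set ?vs)" using x0v by auto
      then have "x0 \<in> \<Inter>(set (map ?\<tau> ?vs))" using map_refinement_projection(2)[OF V(2) vs] by blast
      then show ?thesis using map_refinement_projection(1)[OF V(2) vs] len
        by (simp add: c_def h_def[abs_def] comp_def)
    qed
    finally show ?thesis ..
  qed
  have "trivial_near ?m (\<lambda>xs. f (map h xs)) S"
    unfolding trivial_near_def using fh s(1) by blast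
  moreover have "trivial_near ?m (\<lambda>xs. f (map h xs) - f (map (\<lambda>x. x) xs)) S"
  proof (rule trivial_near_prism[OF e(2) s(1)])
    fix xs assume xs: "small_list s S xs"
    have hx: "h x \<in> S" "dist (h x) x < 5/16 * e" if x: "x \<in> set xs" for x
    proof -
      have vx: "v (\<pi> x) \<in> \<V>" "\<pi> x \<in> v (\<pi> x)" using v[of "\<pi> x"] pi[OF xs x] r(1) by auto
      have "?\<tau> (v (\<pi> x)) \<in> \<U>" "\<pi> x \<in> ?\<tau> (v (\<pi> x))" using refinement_projection[OF V(2) vx(1)] vx(2) by auto
      then have "h x \<in> S" "dist (h x) (\<pi> x) < e/4" unfolding h_def using pt by blast+
      then show "h x \<in> S" "dist (h x) x < 5/16 * e"
        using dist_triangle2[of "h x" x "\<pi> x"] pi[OF xs x] s(2) by auto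
    qed
    have xx: "dist x y < e/16" if "x \<in> set xs" "y \<in> set xs" for x y
      using small_list_dist[OF xs that] s(2) by linarith
    have hxy: "dist (h x) y < e/2" if "x \<in> set xs" "y \<in> set xs" for x y
      using hx(2)[OF that(1)] xx[OF that] dist_triangle[of "h x" y x] e(1) by linarith
    have hh: "dist (h x) (h y) < e" if "x \<in> set xs" "y \<in> set xs" for x y
      using hxy[OF that] hx(2)[OF that(2)] dist_triangle2[of "h x" "h y" y] e(1) by linarith
    show "small_list e S (map (\<lambda>x. x) xs @ map h xs)" unfolding small_list_def
    proof (intro conjI ballI)
      fix y assume "y \<in> set (map (\<lambda>x. x) xs @ map h xs)"
      then consider "y \<in> set xs" | x where "x \<in> set xs" "y = h x" by auto
      then show "\<exists>z\<in>S. dist y z < e"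
      proof cases
        case 1
        then show ?thesis using small_list_near[OF xs 1] s(2) e(1) by force
      next
        case 2
        then show ?thesis using hx(1) e(1) by (intro bexI[of _ y]) auto
      qed
    next
      fix y z assume yz: "y \<in> set (map (\<lambda>x. x) xs @ map h xs)" "z \<in> set (map (\<lambda>x. x) xs @ map h xs)"
      consider "y \<in> set xs" "z \<in> set xs" | x where "x \<in> set xs" "y = h x" "z \<in> set xs"
        | x where "x \<in> set xs" "z = h x" "y \<in> set xs" | x x' where "x \<in> set xs" "y = h x" "x' \<in> set xs" "z = h x'"
        using yz by auto
      then show "dist y z < e"
      proof cases
        case 1 then show ?thesis using xx[of y z] e(1) by simp
      next
        case (2 x) then show ?thesis using hxy[of x z] e(1) by simp
      next
        case (3 x) then show ?thesis using hxy[of x y] e(1) by (simp add: dist_commute)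
      next
        case (4 x x') then show ?thesis using hh by blast
      qed
    qed
  qed
  ultimately have "trivial_near ?m (\<lambda>xs. f (map h xs) - (f (map h xs) - f (map (\<lambda>x. x) xs))) S"
    by (rule trivial_near_diff)
  then show "trivial_near ?m f S" by simp
qed

text \<open>The list length exceeds the degree by one: length 0 is nonemptiness, length 1 is
  connectedness as seen by degree 0, and longer lists are the positive degrees.\<close>

lemma acyclic_in_of_cech_acyclic:
  fixes S :: "'a::heine_borel set"
  assumes S: "compact S" "S \<noteq> {}" and ac: "cech_acyclic S"
  shows "acyclic_in m S"
proof -
  consider "m = 0" | "m = Suc 0" | k where "m = Suc (Suc k)" by (metis nat.exhaust)
  then show ?thesis
  proof cases
    case 1
    then show ?thesis using S(2) by (simp add: acyclic_in_0)
  next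
    case 2
    have "trivial_near (Suc 0) f S" if c: "cocycle_near (Suc 0) f S" for f
    proof -
      obtain e where e: "e > 0" "\<And>xs. length xs = Suc (Suc 0) \<Longrightarrow> small_list e S xs \<Longrightarrow> cobd xs f = 0"
        using c unfolding cocycle_near_def by blast
      \<comment> \<open>The point \<open>y\<close> may lie outside \<open>S\<close>, so this gives
        both local constancy on \<open>S\<close> and the values near \<open>S\<close>.\<close>
      have eq: "f [x] = f [y]" if "x \<in> S" "dist x y < e" for x y
      proof -
        have "small_list e S [x, y]" unfolding small_list_def
          using that e(1) by (auto simp: dist_commute intro!: bexI[of _ x])
        then show ?thesis using e(2)[of "[x, y]"] by simp
      qed
      have "continuous_map (top_of_set S) (discrete_topology UNIV) (\<lambda>x. f [x])"
        unfolding continuous_map_int_iff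
      proof
        fix x assume x: "x \<in> topspace (top_of_set S)"
        have "openin (top_of_set S) (S \<inter> ball x e)" by (intro openin_open_Int) simp
        moreover have "x \<in> S \<inter> ball x e" using x e(1) by simp
        moreover have "\<forall>y\<in>S \<inter> ball x e. f [y] = f [x]" using eq[of x] x by auto
        ultimately show "\<exists>N. openin (top_of_set S) N \<and> x \<in> N \<and> (\<forall>y\<in>N. f [y] = f [x])" by blast
      qed
      moreover have "cech_cohomology 0 (top_of_set S) \<cong> integer_group" using ac unfolding cech_acyclic_def by blast
      ultimately have const: "f [x] = f [y]" if "x \<in> S" "y \<in> S" for x y
        using cech_cohomology_0_const[of "top_of_set S" "\<lambda>x. f [x]" x y] that by auto
      obtain s where s: "s \<in> S" using S(2) by blast
      show ?thesis unfolding trivial_near_def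
      proof (intro exI[of _ "\<lambda>_. f [s]"] exI[of _ e] conjI allI impI)
        fix xs assume xs: "length xs = Suc 0" "small_list e S xs"
        then obtain x where x: "xs = [x]" by (auto simp: length_Suc_conv)
        obtain z where "z \<in> S" "dist x z < e" using small_list_near[OF xs(2), of x] x by auto
        then have "f [x] = f [s]" using eq[of z x] const[OF _ s] by (simp add: dist_commute)
        then show "f xs = cobd xs (\<lambda>_. f [s])" by (simp add: x)
      qed (rule e)
    qed
    then show ?thesis unfolding 2 acyclic_in_def by blast
  next
    case (3 k)
    have "trivial_group (cech_cohomology (Suc k) (top_of_set S))" using ac unfolding cech_acyclic_def by blast
    then show ?thesis unfolding 3 by (rule acyclic_in_of_trivial_cech[OF S(1)])
  qed
qed

section \<open>Translates of a convex body\<close>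

text \<open>Classes on \<open>Y\<close> factor through \<open>F\<close>. The composite
  \<open>i (r y)\<close> is the identity on \<open>Y\<close> only, whereas lists leave
  \<open>Y\<close>; comparing it with the identity as a close map bridges the gap.\<close>

lemma acyclic_in_homeomorphic:
  fixes i :: "'a::heine_borel \<Rightarrow> 'b::heine_borel"
  assumes F: "compact F" and Y: "compact Y" and i: "continuous_on UNIV i" "i ` F \<subseteq> Y"
    and r: "continuous_on UNIV r" "r ` Y \<subseteq> F" and ir: "\<And>y. y \<in> Y \<Longrightarrow> i (r y) = y" and ac: "acyclic_in m F"
  shows "acyclic_in m Y"
  unfolding acyclic_in_def
proof (intro allI impI)
  fix f assume f: "cocycle_near m f Y"
  then have "cocycle_near m (\<lambda>xs. f (map i xs)) F" by (rule cocycle_near_map[OF F i])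
  then have "trivial_near m (\<lambda>xs. f (map i xs)) F" using ac unfolding acyclic_in_def by blast
  then have "trivial_near m (\<lambda>ys. f (map i (map r ys))) Y" by (rule trivial_near_map[OF Y r])
  then have t: "trivial_near m (\<lambda>ys. f (map (\<lambda>y. i (r y)) ys)) Y" by (simp add: comp_def)
  obtain e where e: "e > 0" "\<And>xs. length xs = Suc m \<Longrightarrow> small_list e Y xs \<Longrightarrow> cobd xs f = 0"
    using f unfolding cocycle_near_def by blast
  have "continuous_on UNIV (\<lambda>y. i (r y))"
    by (rule continuous_on_compose2[OF i(1) r(1)]) simp
  then have "trivial_near m (\<lambda>ys. f (map (\<lambda>y. i (r y)) ys) - f (map (\<lambda>y. y) ys)) Y"
    by (intro trivial_near_close_maps[OF Y _ _ _ e]) (use ir e in \<open>auto intro: continuous_intros\<close>)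
  from trivial_near_diff[OF t this] show "trivial_near m f Y" by simp
qed

definition translates_outside :: "'v::real_normed_vector set \<Rightarrow> 'v set \<Rightarrow> 'v set \<Rightarrow> ('v \<times> 'v) set" where
  "translates_outside A B T = {(x, t). t \<in> T \<and> x - t \<in> A \<and> x \<notin> B}"

lemma compact_translates_outside:
  assumes "compact A" "open B" "compact T"
  shows "compact (translates_outside A B T)"
proof -
  have "translates_outside A B T = (\<lambda>(a, t). (a + t, t)) ` (A \<times> T) \<inter> (- B) \<times> UNIV"
    unfolding translates_outside_def by (force simp: image_iff)
  moreover have "compact ((\<lambda>(a, t). (a + t, t)) ` (A \<times> T))"
    unfolding case_prod_beta by (intro compact_continuous_image compact_Times assms continuous_intros)
  moreover have "closed ((- B) \<times> (UNIV :: 'a set))" using assms(2) by (intro closed_Times) auto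
  ultimately show ?thesis by (simp add: compact_Int_closed)
qed

lemma acyclic_translates_outside:
  fixes A B T :: "'v::euclidean_space set"
  assumes A: "compact A" and B: "open B" and T: "compact T" "convex T" "T \<noteq> {}"
    and ac: "\<And>t m. t \<in> T \<Longrightarrow> acyclic_in m ((\<lambda>a. a + t) ` A - B)"
  shows "acyclic_in m (translates_outside A B T)"
proof -
  let ?W = "translates_outside A B T"
  have "acyclic_in m (?W \<inter> snd -` {t})" if t: "t \<in> T" for t m
  proof (rule acyclic_in_homeomorphic[OF _ _ _ _ _ _ _ ac[OF t]])
    show "compact ((\<lambda>a. a + t) ` A - B)"
      by (intro compact_diff compact_continuous_image A B continuous_intros)
    show "compact (?W \<inter> snd -` {t})"
      by (rule compact_Int_closed[OF compact_translates_outside[OF A B T(1)]])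
        (rule closed_vimage[OF closed_singleton continuous_on_snd[OF continuous_on_id]])
    show "(\<lambda>x. (x, t)) ` ((\<lambda>a. a + t) ` A - B) \<subseteq> ?W \<inter> snd -` {t}"
      using t unfolding translates_outside_def by auto
    show "fst ` (?W \<inter> snd -` {t}) \<subseteq> (\<lambda>a. a + t) ` A - B"
      unfolding translates_outside_def by (force simp: image_iff)
  qed (auto intro!: continuous_intros)
  then have "acyclic_in m (?W \<inter> snd -` T)"
    by (rule acyclic_over_convex[OF compact_translates_outside[OF A B T(1)] continuous_on_snd[OF continuous_on_id] T])
  moreover have "?W \<inter> snd -` T = ?W" unfolding translates_outside_def by auto
  ultimately show ?thesis by simp
qed

section \<open>The simplex and the class around the origin\<close>

text \<open>The inequalities \<open>simplex_ineq N i y \<le> 1\<close> cut out a simplex around the origin; \<open>None\<close> stands for the facet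
  opposite to the vertex \<open>(1, \<dots>, 1)\<close>.\<close>

fun simplex_ineq :: "real \<Rightarrow> 'n option \<Rightarrow> real ^ 'n \<Rightarrow> real" where
  "simplex_ineq N None y = - (\<Sum>i\<in>UNIV. y $ i) / N"
| "simplex_ineq N (Some i) y = y $ i"

definition simplex_facet :: "real \<Rightarrow> 'n option \<Rightarrow> (real ^ 'n) set" where
  "simplex_facet N i = {y. simplex_ineq N i y = 1 \<and> (\<forall>j. simplex_ineq N j y \<le> 1)}"

lemma continuous_simplex_ineq: "continuous_on UNIV (simplex_ineq N i)"
  by (cases i) (auto intro!: continuous_intros simp: divide_inverse)

lemma simplex_ineq_linear:
  "simplex_ineq N i (a *\<^sub>R x + b *\<^sub>R y) = a * simplex_ineq N i x + b * simplex_ineq N i y"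
  by (cases i) (simp_all add: sum.distrib sum_distrib_left[symmetric] add_divide_distrib diff_divide_distrib)

lemma convex_simplex_ineq: "convex {y. simplex_ineq N i y \<le> 1}" "convex {y. simplex_ineq N i y = 1}"
proof -
  show "convex {y. simplex_ineq N i y \<le> 1}"
    unfolding convex_def mem_Collect_eq simplex_ineq_linear by (auto intro: convex_bound_le)
  show "convex {y. simplex_ineq N i y = 1}"
    unfolding convex_def mem_Collect_eq simplex_ineq_linear by simp
qed

lemma compact_simplex:
  assumes "N > 0"
  shows "compact {y :: real ^ 'n. \<forall>j. simplex_ineq N j y \<le> 1}"
proof -
  let ?D = "{y :: real ^ 'n. \<forall>j. simplex_ineq N j y \<le> 1}"
  have "closed ?D" by (intro closed_Collect_all closed_Collect_le continuous_simplex_ineq continuous_intros)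
  moreover have "?D \<subseteq> cbox (\<chi> i. - N - CARD('n)) (\<chi> i. 1)"
  proof
    fix y assume y: "y \<in> ?D"
    have le: "y $ i \<le> 1" for i using y by (auto dest!: spec[of _ "Some i"])
    have s: "- (\<Sum>i\<in>UNIV. y $ i) \<le> N"
      using y assms by (auto simp: field_simps dest!: spec[of _ None])
    have "- N - CARD('n) \<le> y $ i" for i
    proof -
      have "(\<Sum>j\<in>UNIV. y $ j) = y $ i + (\<Sum>j\<in>UNIV - {i}. y $ j)" by (simp add: sum.remove)
      moreover have "(\<Sum>j\<in>UNIV - {i}. y $ j) \<le> of_nat (card (UNIV - {i})) * 1"
        by (rule sum_bounded_above) (rule le)
      moreover have "card (UNIV - {i}) \<le> CARD('n)" by (intro card_mono) auto
      ultimately show ?thesis using s by simp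
    qed
    then show "y \<in> cbox (\<chi> i. - N - CARD('n)) (\<chi> i. 1)" using le by (simp add: mem_box_cart)
  qed
  ultimately show ?thesis by (meson bounded_cbox bounded_subset compact_eq_bounded_closed)
qed

lemma convex_simplex: "convex {y :: real ^ 'n. \<forall>j. simplex_ineq N j y \<le> 1}"
proof -
  have "{y :: real ^ 'n. \<forall>j. simplex_ineq N j y \<le> 1} = (\<Inter>j. {y. simplex_ineq N j y \<le> 1})" by auto
  then show ?thesis by (simp add: convex_INT convex_simplex_ineq)
qed

text \<open>A proper family omits some facet, and the vertex opposite to that facet lies on all the
  others.\<close>

lemma simplex_face:
  assumes "N > 0" and J: "J \<noteq> {}" "J \<noteq> UNIV"
  shows "compact (\<Inter>j\<in>J. simplex_facet N j :: (real ^ 'n) set)" "convex (\<Inter>j\<in>J. simplex_facet N j :: (real ^ 'n) set)"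
    "(\<Inter>j\<in>J. simplex_facet N j :: (real ^ 'n) set) \<noteq> {}"
proof -
  have eq: "(simplex_facet N j :: (real ^ 'n) set) = {y. \<forall>j. simplex_ineq N j y \<le> 1} \<inter> {y. simplex_ineq N j y = 1}" for j
    unfolding simplex_facet_def by auto
  have c: "compact (simplex_facet N j :: (real ^ 'n) set)" for j unfolding eq
    by (intro compact_Int_closed compact_simplex assms(1) closed_Collect_eq continuous_simplex_ineq continuous_intros)
  show "compact (\<Inter>j\<in>J. simplex_facet N j :: (real ^ 'n) set)" using J(1) c by (intro compact_Inter) auto
  show "convex (\<Inter>j\<in>J. simplex_facet N j :: (real ^ 'n) set)" unfolding eq
    by (intro convex_INT convex_Int convex_simplex convex_simplex_ineq)
  show "(\<Inter>j\<in>J. simplex_facet N j :: (real ^ 'n) set) \<noteq> {}"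
  proof (cases "None \<in> J")
    case False
    let ?y = "(\<chi> i. 1) :: real ^ 'n"
    have "simplex_ineq N j ?y \<le> 1" for j using assms(1) by (cases j) (auto simp: field_simps)
    moreover have "simplex_ineq N j ?y = 1" if "j \<in> J" for j using that False by (cases j) auto
    ultimately have "?y \<in> (\<Inter>j\<in>J. simplex_facet N j)" unfolding simplex_facet_def by blast
    then show ?thesis by blast
  next
    case True
    then obtain k where k: "Some k \<notin> J" using J(2) by (metis UNIV_eq_I not_None_eq)
    \<comment> \<open>The vertex opposite to the facet \<open>Some k\<close>: its exceptional entry
      makes the coordinates sum to \<open>- N\<close>.\<close>
    let ?y = "(\<chi> i. if i = k then - N - (CARD('n) - 1) else 1) :: real ^ 'n"
    have "(\<Sum>i\<in>UNIV. ?y $ i) = (\<Sum>i\<in>UNIV. (1::real) + (if i = k then - N - CARD('n) else 0))"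
      by (rule sum.cong) (auto simp: of_nat_diff)
    also have "\<dots> = - N" by (simp add: sum.distrib)
    finally have None: "simplex_ineq N None ?y = 1" using assms(1) by simp
    have "simplex_ineq N j ?y \<le> 1" for j
    proof (cases j)
      case None
      then show ?thesis using \<open>simplex_ineq N None ?y = 1\<close> by simp
    qed (use assms(1) in auto)
    moreover have "simplex_ineq N j ?y = 1" if "j \<in> J" for j
      using that k None by (cases j) auto
    ultimately have "?y \<in> (\<Inter>j\<in>J. simplex_facet N j)" unfolding simplex_facet_def by blast
    then show ?thesis by blast
  qed
qed

text \<open>The facets are extended to cones: \<open>K i\<close> collects the points of
  \<open>M\<close> at which the \<open>i\<close>-th form is largest. The cones cover
  \<open>M\<close>, and all forms agree only at the origin. The class thus lives on any compact set
  avoiding the origin and can follow a homotopy off the simplex boundary.\<close>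

lemma simplex_class:
  fixes M :: "(real ^ 'n) set"
  assumes M: "compact M" "0 \<notin> M" and N: "N > 0"
  obtains w where "cocycle_near CARD('n) w M"
    "\<And>(Z :: 'n option \<Rightarrow> 'a::heine_borel set) p. continuous_on UNIV p \<Longrightarrow>
      (\<And>i. compact (Z i) \<and> p ` Z i \<subseteq> M \<inter> simplex_facet N i) \<Longrightarrow>
      (\<And>J m. J \<noteq> UNIV \<Longrightarrow> J \<noteq> {} \<Longrightarrow> acyclic_in m (\<Inter>i\<in>J. Z i)) \<Longrightarrow>
      \<not> trivial_near CARD('n) (\<lambda>xs. w (map p xs)) (\<Union>i. Z i)"
proof -
  define K where "K i = M \<inter> {y. \<forall>j. simplex_ineq N j y \<le> simplex_ineq N i y}" for i
  have cK: "compact (K i)" for i unfolding K_def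
    by (intro compact_Int_closed M closed_Collect_all closed_Collect_le continuous_simplex_ineq)
  have UK: "(\<Union>i. K i) = M"
  proof -
    have "y \<in> (\<Union>i. K i)" if y: "y \<in> M" for y
    proof -
      have "Max (range (\<lambda>j. simplex_ineq N j y)) \<in> range (\<lambda>j. simplex_ineq N j y)" by (rule Max_in) auto
      then obtain i where "Max (range (\<lambda>j. simplex_ineq N j y)) = simplex_ineq N i y" by blast
      then have "simplex_ineq N i y = Max (range (\<lambda>j. simplex_ineq N j y))" by simp
      then have "simplex_ineq N j y \<le> simplex_ineq N i y" for j by simp
      then show ?thesis using y unfolding K_def by blast
    qed
    then show ?thesis unfolding K_def by blast
  qed
  have IK: "(\<Inter>i. K i) = {}"
  proof -
    have False if y: "\<And>i. y \<in> K i" for y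
    proof -
      have eq: "simplex_ineq N i y = simplex_ineq N j y" for i j using y unfolding K_def by (intro antisym) auto
      obtain k :: 'n where True by blast
      define a where "a = y $ k"
      have ya: "y $ i = a" for i using eq[of "Some i" "Some k"] by (simp add: a_def)
      have "- (CARD('n) * a) / N = a" using eq[of None "Some k"] by (simp add: ya)
      then have "(CARD('n) + N) * a = 0" using N by (simp add: field_simps)
      then have "a = 0" using N by (simp add: add_eq_0_iff)
      then have "y = 0" using ya by (simp add: vec_eq_iff)
      then show False using y[of None] M(2) unfolding K_def by simp
    qed
    then show ?thesis by blast
  qed
  have card: "card (UNIV :: 'n option set) - 1 = CARD('n)" by (simp add: card_UNIV_option)
  obtain w where w: "cocycle_near CARD('n) w M"
    "\<And>(Z :: 'n option \<Rightarrow> 'a set) p. continuous_on UNIV p \<Longrightarrow> (\<forall>i\<in>UNIV. compact (Z i) \<and> p ` Z i \<subseteq> K i) \<Longrightarrow>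
      (\<forall>J m. J \<subset> UNIV \<longrightarrow> J \<noteq> {} \<longrightarrow> acyclic_in m (\<Inter>i\<in>J. Z i)) \<Longrightarrow>
      \<not> trivial_near CARD('n) (\<lambda>xs. w (map p xs)) (\<Union>i. Z i)"
    using nerve_class[of "UNIV :: 'n option set" K, where ?'a = 'a, OF _ _ cK IK] unfolding card UK by auto
  show thesis
  proof (rule that[OF w(1)])
    fix Z :: "'n option \<Rightarrow> 'a set" and p
    assume p: "continuous_on UNIV p" and Z: "\<And>i. compact (Z i) \<and> p ` Z i \<subseteq> M \<inter> simplex_facet N i"
      and ac: "\<And>J m. J \<noteq> UNIV \<Longrightarrow> J \<noteq> {} \<Longrightarrow> acyclic_in m (\<Inter>i\<in>J. Z i)"
    have "M \<inter> simplex_facet N i \<subseteq> K i" for i unfolding K_def simplex_facet_def by auto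
    then have "\<forall>i\<in>UNIV. compact (Z i) \<and> p ` Z i \<subseteq> K i" using Z by blast
    then show "\<not> trivial_near CARD('n) (\<lambda>xs. w (map p xs)) (\<Union>i. Z i)"
      using ac by (intro w(2)[OF p]) auto
  qed
qed

text \<open>The pieces \<open>?Z i\<close> lie over single facets, so their intersections lie over
  faces. Faces are convex and the fibres acyclic, which makes these intersections acyclic and the
  class of the cones nontrivial after pullback.\<close>

lemma translates_outside_class:
  fixes A B M :: "(real ^ 'n) set" and \<Lambda> \<Gamma> :: "real ^ 'n \<Rightarrow> real ^ 'n"
  assumes A: "compact A" and B: "open B" and N: "N > 0"
    and \<Lambda>: "linear \<Lambda>" "linear \<Gamma>" "\<And>y. \<Lambda> (\<Gamma> y) = y" "\<And>v. \<Gamma> (\<Lambda> v) = v"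
    and ac: "\<And>t i m. \<Lambda> (t - c) \<in> simplex_facet N i \<Longrightarrow> acyclic_in m ((\<lambda>a. a + t) ` A - B)"
    and M: "compact M" "0 \<notin> M" "\<And>i. simplex_facet N i \<subseteq> M"
  obtains w where "cocycle_near CARD('n) w M"
    "\<not> trivial_near CARD('n) (\<lambda>zs. w (map (\<lambda>z. \<Lambda> (snd z - c)) zs))
      (translates_outside A B {t. \<exists>i. \<Lambda> (t - c) \<in> simplex_facet N i})"
proof -
  obtain w where w: "cocycle_near CARD('n) w M"
    "\<And>(Z :: 'n option \<Rightarrow> ((real ^ 'n) \<times> (real ^ 'n)) set) p. continuous_on UNIV p \<Longrightarrow>
      (\<And>i. compact (Z i) \<and> p ` Z i \<subseteq> M \<inter> simplex_facet N i) \<Longrightarrow>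
      (\<And>J m. J \<noteq> UNIV \<Longrightarrow> J \<noteq> {} \<Longrightarrow> acyclic_in m (\<Inter>i\<in>J. Z i)) \<Longrightarrow>
      \<not> trivial_near CARD('n) (\<lambda>xs. w (map p xs)) (\<Union>i. Z i)"
    using simplex_class[OF M(1,2) N, where ?'a = "(real ^ 'n) \<times> (real ^ 'n)"] by metis
  define T where "T J = {t. \<forall>j\<in>J. \<Lambda> (t - c) \<in> simplex_facet N j}" for J
  have T: "T J = (\<lambda>y. c + \<Gamma> y) ` (\<Inter>j\<in>J. simplex_facet N j)" for J
  proof (intro equalityI subsetI)
    fix t assume "t \<in> T J"
    then show "t \<in> (\<lambda>y. c + \<Gamma> y) ` (\<Inter>j\<in>J. simplex_facet N j)"
      by (intro image_eqI[of _ _ "\<Lambda> (t - c)"]) (auto simp: T_def \<Lambda>)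
  qed (auto simp: T_def \<Lambda>)
  have cT: "compact (T J)" "convex (T J)" "T J \<noteq> {}" if J: "J \<noteq> UNIV" "J \<noteq> {}" for J
  proof -
    note f = simplex_face[OF N J(2,1)]
    show "compact (T J)" unfolding T
      by (intro compact_continuous_image f(1) continuous_intros linear_continuous_on_compose[OF _ \<Lambda>(2)])
    have "T J = (\<lambda>x. c + x) ` \<Gamma> ` (\<Inter>j\<in>J. simplex_facet N j)" unfolding T by (simp add: image_image)
    then show "convex (T J)" by (simp add: convex_linear_image[OF \<Lambda>(2) f(2)] convex_translation)
    show "T J \<noteq> {}" unfolding T using f(3) by simp
  qed
  let ?Z = "\<lambda>i. translates_outside A B (T {i})"
  have "\<not> trivial_near CARD('n) (\<lambda>zs. w (map (\<lambda>z. \<Lambda> (snd z - c)) zs)) (\<Union>i. ?Z i)"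
  proof (rule w(2))
    have "continuous_on UNIV \<Lambda>" using \<Lambda>(1) by (simp add: linear_continuous_on linear_conv_bounded_linear)
    then show "continuous_on UNIV (\<lambda>z :: (real ^ 'n) \<times> (real ^ 'n). \<Lambda> (snd z - c))"
      by (rule continuous_on_compose2) (auto intro!: continuous_intros)
    show "compact (?Z i) \<and> (\<lambda>z. \<Lambda> (snd z - c)) ` ?Z i \<subseteq> M \<inter> simplex_facet N i" for i
    proof
      have "{i} \<noteq> UNIV" by (metis UNIV_I option.distinct(1) singletonD)
      then show "compact (?Z i)" by (intro compact_translates_outside A B cT) auto
      show "(\<lambda>z. \<Lambda> (snd z - c)) ` ?Z i \<subseteq> M \<inter> simplex_facet N i"
        using M(3)[of i] unfolding translates_outside_def T_def by auto
    qed
    fix J :: "'n option set" and m assume J: "J \<noteq> UNIV" "J \<noteq> {}"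
    have "(\<Inter>i\<in>J. ?Z i) = translates_outside A B (T J)"
      using J(2) unfolding translates_outside_def T_def by auto
    moreover have "acyclic_in m (translates_outside A B (T J))"
      by (rule acyclic_translates_outside[OF A B cT[OF J]]) (use J(2) ac in \<open>auto simp: T_def\<close>)
    ultimately show "acyclic_in m (\<Inter>i\<in>J. ?Z i)" by simp
  qed
  moreover have "(\<Union>i. ?Z i) = translates_outside A B {t. \<exists>i. \<Lambda> (t - c) \<in> simplex_facet N i}"
    unfolding translates_outside_def T_def by auto
  ultimately show thesis using that w(1) by simp
qed

lemma zero_notin_simplex_facet: "0 \<notin> simplex_facet N i"
proof -
  have "simplex_ineq N i 0 = 0" by (cases i) auto
  then show ?thesis unfolding simplex_facet_def by simp
qed

lemma compact_simplex_facets: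
  assumes "N > 0"
  shows "compact (\<Union>i. simplex_facet N i :: (real ^ 'n) set)"
proof -
  have "{i :: 'n option} \<noteq> UNIV" for i by (metis UNIV_I option.distinct(1) singletonD)
  then have "compact (simplex_facet N i :: (real ^ 'n) set)" for i
    using simplex_face(1)[OF assms, of "{i}"] by simp
  then show ?thesis by (intro compact_UN) auto
qed

lemma compact_translates_outside_facets:
  fixes A B :: "(real ^ 'n) set" and \<Lambda> \<Gamma> :: "real ^ 'n \<Rightarrow> real ^ 'n"
  assumes "compact A" "open B" "N > 0" and \<Gamma>: "linear \<Gamma>" "\<And>y. \<Lambda> (\<Gamma> y) = y" "\<And>v. \<Gamma> (\<Lambda> v) = v"
  shows "compact (translates_outside A B {t. \<exists>i. \<Lambda> (t - c) \<in> simplex_facet N i})"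
proof -
  have "{t. \<exists>i. \<Lambda> (t - c) \<in> simplex_facet N i} = (\<lambda>y. c + \<Gamma> y) ` (\<Union>i. simplex_facet N i)"
  proof (intro equalityI subsetI)
    fix t assume "t \<in> {t. \<exists>i. \<Lambda> (t - c) \<in> simplex_facet N i}"
    then show "t \<in> (\<lambda>y. c + \<Gamma> y) ` (\<Union>i. simplex_facet N i)"
      by (intro image_eqI[of _ _ "\<Lambda> (t - c)"]) (auto simp: \<Gamma>)
  qed (auto simp: \<Gamma>)
  moreover have "continuous_on X \<Gamma>" for X
    using \<Gamma>(1) by (simp add: linear_continuous_on linear_conv_bounded_linear)
  then have "compact ((\<lambda>y. c + \<Gamma> y) ` (\<Union>i. simplex_facet N i))"
    by (intro compact_continuous_image compact_simplex_facets assms continuous_intros)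
  ultimately show ?thesis by (simp add: compact_translates_outside assms)
qed

text \<open>The track of the straight homotopy from \<open>p\<close> to \<open>q\<close>; it becomes
  part of the set \<open>M\<close> that carries the class.\<close>

definition segments :: "('a \<Rightarrow> 'b::real_vector) \<Rightarrow> ('a \<Rightarrow> 'b) \<Rightarrow> 'a set \<Rightarrow> 'b set" where
  "segments p q Z = (\<Union>z\<in>Z. closed_segment (p z) (q z))"

lemma compact_segments:
  fixes p q :: "'a::topological_space \<Rightarrow> 'b::real_normed_vector"
  assumes Z: "compact Z" and p: "continuous_on UNIV p" and q: "continuous_on UNIV q"
  shows "compact (segments p q Z)"
proof -
  have "segments p q Z = (\<lambda>(s, z). (1 - s) *\<^sub>R p z + s *\<^sub>R q z) ` ({0..1} \<times> Z)"
    unfolding segments_def closed_segment_def by (force simp: image_iff)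
  moreover have "compact \<dots>"
    unfolding case_prod_beta
    by (intro compact_continuous_image compact_Times Z compact_Icc continuous_intros
        continuous_on_compose2[OF p] continuous_on_compose2[OF q]) auto
  ultimately show ?thesis by simp
qed

lemma zero_notin_segments:
  assumes \<Lambda>: "linear \<Lambda>" "\<And>v. \<Gamma> (\<Lambda> v) = v"
    and nz: "\<And>z s. z \<in> Z \<Longrightarrow> 0 \<le> s \<Longrightarrow> s \<le> 1 \<Longrightarrow> (1 - s) *\<^sub>R p z + s *\<^sub>R q z \<noteq> 0"
  shows "0 \<notin> segments (\<lambda>z. \<Lambda> (p z)) (\<lambda>z. \<Lambda> (q z)) Z"
proof
  assume "0 \<in> segments (\<lambda>z. \<Lambda> (p z)) (\<lambda>z. \<Lambda> (q z)) Z"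
  then obtain z s where z: "z \<in> Z" "0 \<le> s" "s \<le> 1" "0 = (1 - s) *\<^sub>R \<Lambda> (p z) + s *\<^sub>R \<Lambda> (q z)"
    unfolding segments_def closed_segment_def by auto
  then have "\<Lambda> ((1 - s) *\<^sub>R p z + s *\<^sub>R q z) = \<Lambda> 0"
    using \<Lambda>(1) by (simp add: linear_add linear_scale linear_0)
  then show False using \<Lambda>(2) nz[OF z(1-3)] by metis
qed

text \<open>Bounds the boundary of the unscaled simplex away from the origin, so that a scaled copy
  avoids any prescribed ball.\<close>

lemma facet_norm:
  fixes y :: "real ^ 'n"
  assumes "y \<in> simplex_facet 1 i"
  shows "1 \<le> CARD('n) * norm y"
proof (cases i)
  case None
  have "1 = - (\<Sum>j\<in>UNIV. y $ j)" using assms None by (simp add: simplex_facet_def)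
  also have "\<dots> \<le> (\<Sum>j\<in>UNIV. \<bar>y $ j\<bar>)" by (simp add: sum_negf[symmetric] sum_mono)
  also have "\<dots> \<le> CARD('n) * norm y" by (rule sum_bounded_above) (rule component_le_norm_cart)
  finally show ?thesis .
next
  case (Some j)
  have "1 = y $ j" using assms Some by (simp add: simplex_facet_def)
  also have "\<dots> \<le> norm y" using component_le_norm_cart[of y j] by simp
  also have "\<dots> \<le> CARD('n) * norm y" using mult_right_mono[of 1 "real CARD('n)" "norm y"] by simp
  finally show ?thesis .
qed

text \<open>Otherwise the pairs \<open>(x, t)\<close> over a large full simplex form an acyclic set, to which the map \<open>x - b\<close>
  extends; over the boundary it is homotopic to \<open>t\<close>.\<close>

lemma exists_translate_inside:
  fixes A B :: "(real ^ 'n) set"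
  assumes A: "compact A" and B: "open B" "B \<noteq> {}"
    and ac: "\<And>t m. (\<lambda>a. a + t) ` A - B \<noteq> {} \<Longrightarrow> acyclic_in m ((\<lambda>a. a + t) ` A - B)"
  shows "\<exists>t. \<forall>a\<in>A. a + t \<in> B"
proof (rule ccontr)
  assume none: "\<nexists>t. \<forall>a\<in>A. a + t \<in> B"
  have ac: "acyclic_in m ((\<lambda>a. a + t) ` A - B)" for t m
  proof (rule ac)
    obtain a where "a \<in> A" "a + t \<notin> B" using none by blast
    then show "(\<lambda>a. a + t) ` A - B \<noteq> {}" by blast
  qed
  obtain b where b: "b \<in> B" using B(2) by blast
  have "bounded ((\<lambda>a. a - b) ` A)"
    by (intro compact_imp_bounded compact_continuous_image A continuous_intros)
  then obtain \<alpha> where \<alpha>: "\<alpha> > 0" "\<And>a. a \<in> A \<Longrightarrow> norm (a - b) \<le> \<alpha>"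
    unfolding bounded_pos by auto
  \<comment> \<open>Large enough that each \<open>t\<close> on the boundary is longer than
    \<open>\<alpha>\<close>, while the homotopy from \<open>t\<close> to \<open>x - b\<close> moves
    by \<open>x - t - b\<close>, of norm at most \<open>\<alpha>\<close>. So it never reaches the
    origin.\<close>
  define R where "R = CARD('n) * \<alpha> + 1"
  have R: "R > 0" unfolding R_def using \<alpha>(1) by (simp add: add_pos_pos)
  let ?L = "\<lambda>v :: real ^ 'n. (1 / R) *\<^sub>R v" and ?G = "\<lambda>v :: real ^ 'n. R *\<^sub>R v"
  have L: "linear ?L" "linear ?G" "\<And>y. ?L (?G y) = y" "\<And>v. ?G (?L v) = v"
    using R by (auto intro: linear_scaleR)
  let ?S = "{t. \<exists>i. ?L (t - 0) \<in> simplex_facet 1 i}" and ?T = "{t. \<forall>j. simplex_ineq 1 j (?L t) \<le> 1}"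
  let ?Z = "translates_outside A B ?S" and ?Y = "translates_outside A B ?T"
  have T: "?T = ?G ` {y. \<forall>j. simplex_ineq 1 j y \<le> 1}"
  proof (intro equalityI subsetI)
    fix t assume "t \<in> ?T"
    then show "t \<in> ?G ` {y. \<forall>j. simplex_ineq 1 j y \<le> 1}"
      using R by (intro image_eqI[of _ _ "?L t"]) auto
  qed (use R in auto)
  have acY: "acyclic_in m ?Y" for m
  proof (rule acyclic_translates_outside[OF A B(1) _ _ _ ac])
    show "compact ?T" unfolding T by (intro compact_scaling compact_simplex) simp
    show "convex ?T" unfolding T by (intro convex_scaling convex_simplex)
    have "simplex_ineq 1 j (0 :: real ^ 'n) \<le> 1" for j by (cases j) auto
    then show "?T \<noteq> {}" by (auto intro!: exI[of _ 0])
  qed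
  have Z: "compact ?Z" by (rule compact_translates_outside_facets[OF A B(1) _ L(2-4)]) simp
  have Y: "compact ?Y" unfolding T
    by (intro compact_translates_outside A B compact_scaling compact_simplex) simp
  have ZY: "?Z \<subseteq> ?Y" unfolding translates_outside_def simplex_facet_def by auto
  let ?p = "\<lambda>z :: (real ^ 'n) \<times> (real ^ 'n). ?L (snd z - 0)" and ?q = "\<lambda>z :: (real ^ 'n) \<times> (real ^ 'n). ?L (fst z - b)"
  have pq: "continuous_on UNIV ?p" "continuous_on X ?q" for X by (intro continuous_intros)+
  \<comment> \<open>The image of \<open>?Y\<close> is included so that the class can be pulled back
    along \<open>?q\<close> to all of the acyclic set \<open>?Y\<close>; it avoids the origin since
    \<open>b\<close> is in \<open>B\<close> and \<open>x\<close> is not.\<close>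
  let ?M = "(\<Union>i. simplex_facet 1 i) \<union> segments ?p ?q ?Z \<union> ?q ` ?Y"
  have "0 \<notin> segments ?p ?q ?Z"
  proof (rule zero_notin_segments[OF L(1,4)])
    fix z s assume z: "z \<in> ?Z" and s: "0 \<le> s" "s \<le> (1::real)"
    obtain x t where xt: "z = (x, t)" "t \<in> ?S" "x - t \<in> A" using z unfolding translates_outside_def by auto
    obtain i where "?L t \<in> simplex_facet 1 i" using xt(2) by auto
    then have "R \<le> CARD('n) * norm t" using facet_norm[of "?L t"] R by (simp add: field_simps)
    then have "norm t > \<alpha>"
      unfolding R_def using mult_left_mono[of "norm t" \<alpha> "real CARD('n)"] by linarith
    moreover have "norm (s *\<^sub>R (x - t - b)) \<le> 1 * \<alpha>"
      unfolding norm_scaleR using s \<alpha>(2)[OF xt(3)] by (intro mult_mono) auto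
    moreover have "(1 - s) *\<^sub>R (snd z - 0) + s *\<^sub>R (fst z - b) = t + s *\<^sub>R (x - t - b)"
      by (simp add: xt(1) algebra_simps)
    ultimately show "(1 - s) *\<^sub>R (snd z - 0) + s *\<^sub>R (fst z - b) \<noteq> 0"
      by (metis add_eq_0_iff linorder_not_less mult_1 norm_minus_cancel)
  qed
  moreover have "0 \<notin> ?q ` ?Y" using b R unfolding translates_outside_def by auto
  ultimately have M0: "0 \<notin> ?M" using zero_notin_simplex_facet by blast
  have M: "compact ?M"
    by (intro compact_Un compact_simplex_facets compact_segments Z pq compact_continuous_image Y) simp
  obtain w where w: "cocycle_near CARD('n) w ?M"
    "\<not> trivial_near CARD('n) (\<lambda>zs. w (map ?p zs)) ?Z"
  proof (rule translates_outside_class[OF A B(1) zero_less_one L ac M M0])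
    show "simplex_facet 1 i \<subseteq> ?M" for i by blast
  qed (assumption | rule that)+
  have "cocycle_near CARD('n) (\<lambda>zs. w (map ?q zs)) ?Y"
    by (rule cocycle_near_map[OF Y pq(2) _ w(1)]) blast
  then have "trivial_near CARD('n) (\<lambda>zs. w (map ?q zs)) ?Y" using acY unfolding acyclic_in_def by blast
  then have "trivial_near CARD('n) (\<lambda>zs. w (map ?q zs)) ?Z" using ZY by (rule trivial_near_mono)
  moreover have "trivial_near CARD('n) (\<lambda>zs. w (map ?q zs) - w (map ?p zs)) ?Z"
    by (rule trivial_near_straight_homotopy[OF Z pq _ w(1)]) (auto simp: segments_def)
  ultimately have "trivial_near CARD('n) (\<lambda>zs. w (map ?q zs) - (w (map ?q zs) - w (map ?p zs))) ?Z"
    by (rule trivial_near_diff)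
  then show False using w(2) by simp
qed

text \<open>Trading a coordinate in which \<open>u\<close> is nonzero for \<open>u\<close> itself
  keeps the change of coordinates invertible. The facet \<open>Some k\<close> then lies in a
  hyperplane with normal \<open>u\<close>, and \<open>s\<close> and \<open>R\<close> set the
  distances of the facets.\<close>

lemma functional_coordinates:
  fixes u :: "real ^ 'n"
  assumes "u \<noteq> 0" "s > 0" "R > 0"
  obtains k \<Lambda> \<Gamma> where "linear \<Lambda>" "linear \<Gamma>" "\<And>y. \<Lambda> (\<Gamma> y) = y" "\<And>v. \<Gamma> (\<Lambda> v) = v"
    "\<And>v. \<Lambda> v $ k = u \<bullet> v / s" "\<And>v i. i \<noteq> k \<Longrightarrow> \<Lambda> v $ i = v $ i / R"
proof -
  obtain k where k: "u $ k \<noteq> 0" using assms(1) by (auto simp: vec_eq_iff)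
  define \<Lambda> where "\<Lambda> v = (\<chi> i. if i = k then u \<bullet> v / s else v $ i / R)" for v :: "real ^ 'n"
  have lin: "linear \<Lambda>"
    by (rule linearI) (auto simp: \<Lambda>_def vec_eq_iff inner_add_right add_divide_distrib)
  have "v = 0" if "\<Lambda> v = 0" for v
  proof -
    have v: "v $ i = 0" if "i \<noteq> k" for i
      using arg_cong[OF \<open>\<Lambda> v = 0\<close>, of "\<lambda>x. x $ i"] that assms(3) by (simp add: \<Lambda>_def)
    have "u \<bullet> v = 0"
      using arg_cong[OF \<open>\<Lambda> v = 0\<close>, of "\<lambda>x. x $ k"] assms(2) by (simp add: \<Lambda>_def)
    moreover have "u \<bullet> v = u $ k * v $ k + (\<Sum>i\<in>UNIV - {k}. u $ i * v $ i)"
      unfolding inner_vec_def by (simp add: sum.remove)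
    moreover have "(\<Sum>i\<in>UNIV - {k}. u $ i * v $ i) = 0" using v by (intro sum.neutral) auto
    ultimately have "v $ k = 0" using k by simp
    then show ?thesis using v by (metis vec_eq_iff zero_index)
  qed
  then have "inj \<Lambda>" using linear_injective_0[OF lin] by blast
  then obtain \<Gamma> where "linear \<Gamma>" "\<And>v. \<Gamma> (\<Lambda> v) = v" "\<And>y. \<Lambda> (\<Gamma> y) = y"
    using linear_injective_isomorphism[OF lin] by blast
  then show thesis using lin by (intro that[of \<Lambda> \<Gamma> k]) (auto simp: \<Lambda>_def)
qed

text \<open>On the pairs \<open>(x, t)\<close> with \<open>x \<in> A + t\<close>, \<open>x \<notin> B\<close> over a simplex boundary around \<open>c\<close>, the map \<open>t - c\<close> is
  homotopic in the complement of the origin to \<open>x - a' - c\<close> (by convexity of \<open>A\<close>), then to \<open>x - y\<close>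
  (by convexity of \<open>B\<close>), and then to the constant \<open>- u\<close> because one facet lies in the hyperplane where \<open>u\<close> is
  \<open>\<sigma>\<close>. This contradicts the nontriviality of the pulled back class.\<close>

lemma no_separating_functional:
  fixes A B :: "(real ^ 'n) set"
  assumes A: "compact A" "convex A" and B: "open B" "convex B" "bounded B"
    and ac: "\<And>t m. (\<lambda>a. a + t) ` A - B \<noteq> {} \<Longrightarrow> acyclic_in m ((\<lambda>a. a + t) ` A - B)"
    and c: "\<And>a. a \<in> A \<Longrightarrow> a + c \<in> B" and u: "u \<noteq> 0"
    and a': "a' \<in> A" "\<And>a. a \<in> A \<Longrightarrow> u \<bullet> a \<le> u \<bullet> a'"
    and \<sigma>: "\<And>t. (\<And>a. a \<in> A \<Longrightarrow> a + t \<in> B) \<Longrightarrow> u \<bullet> t < \<sigma>"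
    and y: "y \<in> B" "u \<bullet> y > \<sigma> + u \<bullet> a'"
  shows False
proof -
  define C where "C = {t. \<forall>a\<in>A. a + t \<in> B}"
  have "C \<subseteq> (\<lambda>b. b - a') ` B" unfolding C_def using a'(1) by (force simp: image_iff algebra_simps)
  moreover have "bounded ((\<lambda>b. b - a') ` B)" using B(3) by (rule bounded_translation_minus)
  ultimately have "bounded ((\<lambda>t. t - c) ` C)" by (intro bounded_translation_minus) (rule bounded_subset)
  then obtain R where R: "R > 0" "\<And>t. t \<in> C \<Longrightarrow> norm (t - c) < R"
    unfolding bounded_pos_less by auto
  have s: "\<sigma> - u \<bullet> c > 0" using \<sigma>[OF c] by simp
  obtain k \<Lambda> \<Gamma> where L: "linear \<Lambda>" "linear \<Gamma>" "\<And>y. \<Lambda> (\<Gamma> y) = y" "\<And>v. \<Gamma> (\<Lambda> v) = v"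
    and Lk: "\<And>v. \<Lambda> v $ k = u \<bullet> v / (\<sigma> - u \<bullet> c)" and Li: "\<And>v i. i \<noteq> k \<Longrightarrow> \<Lambda> v $ i = v $ i / R"
    using functional_coordinates[OF u s R(1)] by metis
  have "bounded (\<Lambda> ` (\<lambda>t. t - c) ` C)"
    using bounded_linear_image[OF \<open>bounded ((\<lambda>t. t - c) ` C)\<close>] L(1) by (simp add: linear_conv_bounded_linear)
  then obtain D where D: "D > 0" "\<And>t. t \<in> C \<Longrightarrow> norm (\<Lambda> (t - c)) \<le> D" unfolding bounded_pos by auto
  \<comment> \<open>The coordinates of \<open>C\<close> relative to \<open>c\<close> are bounded by
    \<open>D\<close>, so their sum stays above \<open>- N\<close> and the facet \<open>None\<close>
    misses \<open>C\<close>.\<close>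
  define N where "N = CARD('n) * D + 1"
  have N: "N > 0" unfolding N_def using D(1) by (simp add: add_pos_pos)
  have lt: "simplex_ineq N i (\<Lambda> (t - c)) < 1" if t: "t \<in> C" for t i
  proof (cases i)
    case None
    have "- (\<Sum>j\<in>UNIV. \<Lambda> (t - c) $ j) \<le> (\<Sum>j\<in>UNIV. \<bar>\<Lambda> (t - c) $ j\<bar>)"
      by (simp add: sum_negf[symmetric] sum_mono)
    also have "\<dots> \<le> CARD('n) * D"
      by (rule sum_bounded_above) (meson D(2) component_le_norm_cart order_trans t)
    finally show ?thesis using N None by (simp add: N_def field_simps)
  next
    case (Some i)
    show ?thesis
    proof (cases "i = k")
      case True
      have "u \<bullet> t < \<sigma>" using t by (intro \<sigma>) (auto simp: C_def)
      then show ?thesis using Some True s by (simp add: Lk inner_diff_right)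
    next
      case False
      have "(t - c) $ i < R" using component_le_norm_cart[of "t - c" i] R(2)[OF t] by linarith
      then show ?thesis using Some False R(1) by (simp add: Li)
    qed
  qed
  have acS: "acyclic_in m ((\<lambda>a. a + t) ` A - B)" if "\<Lambda> (t - c) \<in> simplex_facet N i" for t i m
  proof (rule ac)
    have "t \<notin> C" using lt[of t i] that unfolding simplex_facet_def by auto
    then show "(\<lambda>a. a + t) ` A - B \<noteq> {}" unfolding C_def by blast
  qed
  let ?S = "{t. \<exists>i. \<Lambda> (t - c) \<in> simplex_facet N i}"
  let ?Z = "translates_outside A B ?S"
  have ut: "u \<bullet> t \<le> \<sigma>" if "t \<in> ?S" for t
  proof -
    have "simplex_ineq N (Some k) (\<Lambda> (t - c)) \<le> 1" using that unfolding simplex_facet_def by blast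
    then show ?thesis using s by (simp add: Lk inner_diff_right)
  qed
  have Z: "compact ?Z" by (rule compact_translates_outside_facets[OF A(1) B(1) N L(2-4)])
  define p0 where "p0 z = snd z - c" for z :: "(real ^ 'n) \<times> (real ^ 'n)"
  define p1 where "p1 z = fst z - a' - c" for z :: "(real ^ 'n) \<times> (real ^ 'n)"
  define p2 where "p2 z = fst z - y" for z :: "(real ^ 'n) \<times> (real ^ 'n)"
  define p3 where "p3 z = - u" for z :: "(real ^ 'n) \<times> (real ^ 'n)"
  have "continuous_on UNIV \<Lambda>" using L(1) by (simp add: linear_continuous_on linear_conv_bounded_linear)
  then have cont: "continuous_on UNIV (\<lambda>z. \<Lambda> (p0 z))" "continuous_on UNIV (\<lambda>z. \<Lambda> (p1 z))"
    "continuous_on UNIV (\<lambda>z. \<Lambda> (p2 z))" "continuous_on UNIV (\<lambda>z. \<Lambda> (p3 z))"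
    unfolding p0_def p1_def p2_def p3_def
    by (auto intro!: continuous_on_compose2[of UNIV \<Lambda>] continuous_intros)
  \<comment> \<open>Room for the whole argument: the facets where the class is nontrivial, the
    tracks of the three homotopies, and the constant at which they end.\<close>
  define M where "M = (\<Union>i. simplex_facet N i) \<union> segments (\<lambda>z. \<Lambda> (p0 z)) (\<lambda>z. \<Lambda> (p1 z)) ?Z \<union>
    segments (\<lambda>z. \<Lambda> (p1 z)) (\<lambda>z. \<Lambda> (p2 z)) ?Z \<union> segments (\<lambda>z. \<Lambda> (p2 z)) (\<lambda>z. \<Lambda> (p3 z)) ?Z \<union> {\<Lambda> (- u)}"
  have M: "compact M" unfolding M_def by (intro compact_Un compact_simplex_facets N compact_segments Z cont) simp
  have "0 \<notin> segments (\<lambda>z. \<Lambda> (p0 z)) (\<lambda>z. \<Lambda> (p1 z)) ?Z"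
  proof (rule zero_notin_segments[OF L(1,4)], rule notI)
    fix z s assume z: "z \<in> ?Z" and s: "0 \<le> s" "s \<le> (1::real)" and 0: "(1 - s) *\<^sub>R p0 z + s *\<^sub>R p1 z = 0"
    obtain x t where xt: "z = (x, t)" "x - t \<in> A" "x \<notin> B" using z unfolding translates_outside_def by auto
    \<comment> \<open>Were the origin met, this point of \<open>A\<close> would be
      \<open>x - c\<close>, which would put \<open>x\<close> into \<open>A + c\<close> and hence
      into \<open>B\<close>.\<close>
    have "(1 - s) *\<^sub>R (x - t) + s *\<^sub>R a' \<in> A" using A(2) xt(2) a'(1) s by (simp add: convex_def)
    moreover have "(1 - s) *\<^sub>R (x - t) + s *\<^sub>R a' = x - c - ((1 - s) *\<^sub>R p0 z + s *\<^sub>R p1 z)"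
      unfolding p0_def p1_def xt(1) by (simp add: algebra_simps)
    ultimately show False using c[of "x - c"] 0 xt(3) by simp
  qed
  moreover have "0 \<notin> segments (\<lambda>z. \<Lambda> (p1 z)) (\<lambda>z. \<Lambda> (p2 z)) ?Z"
  proof (rule zero_notin_segments[OF L(1,4)], rule notI)
    fix z s assume z: "z \<in> ?Z" and s: "0 \<le> s" "s \<le> (1::real)" and 0: "(1 - s) *\<^sub>R p1 z + s *\<^sub>R p2 z = 0"
    \<comment> \<open>Were the origin met, this point of \<open>B\<close> would be \<open>x\<close>
      itself.\<close>
    have "(1 - s) *\<^sub>R (a' + c) + s *\<^sub>R y \<in> B" using B(2) c[OF a'(1)] y(1) s by (simp add: convex_def)
    moreover have "(1 - s) *\<^sub>R (a' + c) + s *\<^sub>R y = fst z - ((1 - s) *\<^sub>R p1 z + s *\<^sub>R p2 z)"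
      unfolding p1_def p2_def by (simp add: algebra_simps)
    ultimately show False using 0 z unfolding translates_outside_def by auto
  qed
  moreover have "0 \<notin> segments (\<lambda>z. \<Lambda> (p2 z)) (\<lambda>z. \<Lambda> (p3 z)) ?Z"
  proof (rule zero_notin_segments[OF L(1,4)], rule notI)
    fix z s assume z: "z \<in> ?Z" and s: "0 \<le> s" "s \<le> (1::real)" and 0: "(1 - s) *\<^sub>R p2 z + s *\<^sub>R p3 z = 0"
    obtain x t where xt: "z = (x, t)" "t \<in> ?S" "x - t \<in> A" using z unfolding translates_outside_def by auto
    have "u \<bullet> (x - t) \<le> u \<bullet> a'" using a'(2) xt(3) by blast
    \<comment> \<open>Here the facet in the hyperplane pays off: \<open>u \<bullet> t\<close> is at
      most \<open>\<sigma>\<close>, so \<open>x - y\<close> lies in the open half-space that also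
      contains \<open>- u\<close>.\<close>
    then have neg: "u \<bullet> (x - y) < 0" using ut[OF xt(2)] y(2) by (simp add: inner_diff_right)
    have "u \<bullet> ((1 - s) *\<^sub>R p2 z + s *\<^sub>R p3 z) = (1 - s) * (u \<bullet> (x - y)) - s * (u \<bullet> u)"
      unfolding p2_def p3_def xt(1) by (simp add: inner_diff_right algebra_simps)
    also have "\<dots> < 0"
    proof (cases "s = 0")
      case False
      then have "s * (u \<bullet> u) > 0" using s u by simp
      moreover have "(1 - s) * (u \<bullet> (x - y)) \<le> 0" using s neg by (simp add: mult_nonneg_nonpos)
      ultimately show ?thesis by linarith
    qed (use neg in simp)
    finally show False using 0 by simp
  qed
  moreover have "\<Lambda> (- u) \<noteq> 0"
  proof
    assume "\<Lambda> (- u) = 0"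
    then have "\<Lambda> (- u) = \<Lambda> 0" using L(1) by (simp add: linear_0)
    then show False using L(4)[of "- u"] L(4)[of 0] u by simp
  qed
  ultimately have M0: "0 \<notin> M" unfolding M_def using zero_notin_simplex_facet by auto
  obtain w where w: "cocycle_near CARD('n) w M"
    "\<not> trivial_near CARD('n) (\<lambda>zs. w (map (\<lambda>z. \<Lambda> (snd z - c)) zs)) ?Z"
  proof (rule translates_outside_class[OF A(1) B(1) N L acS M M0])
    show "simplex_facet N i \<subseteq> M" for i unfolding M_def by blast
  qed (assumption | rule that)+
  have t01: "trivial_near CARD('n) (\<lambda>zs. w (map (\<lambda>z. \<Lambda> (p1 z)) zs) - w (map (\<lambda>z. \<Lambda> (p0 z)) zs)) ?Z"
    by (rule trivial_near_straight_homotopy[OF Z cont(1,2) _ w(1)]) (auto simp: segments_def M_def)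
  have t12: "trivial_near CARD('n) (\<lambda>zs. w (map (\<lambda>z. \<Lambda> (p2 z)) zs) - w (map (\<lambda>z. \<Lambda> (p1 z)) zs)) ?Z"
    by (rule trivial_near_straight_homotopy[OF Z cont(2,3) _ w(1)]) (auto simp: segments_def M_def)
  have t23: "trivial_near CARD('n) (\<lambda>zs. w (map (\<lambda>z. \<Lambda> (p3 z)) zs) - w (map (\<lambda>z. \<Lambda> (p2 z)) zs)) ?Z"
    by (rule trivial_near_straight_homotopy[OF Z cont(3,4) _ w(1)]) (auto simp: segments_def M_def)
  have "cocycle_near CARD('n) w {\<Lambda> (- u)}" using w(1) by (rule cocycle_near_mono) (simp add: M_def)
  then have "trivial_near CARD('n) (\<lambda>zs. w (map (\<lambda>z. \<Lambda> (p3 z)) zs)) ?Z"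
    unfolding p3_def by (rule trivial_near_const_map)
  from trivial_near_diff[OF this trivial_near_add[OF t01 trivial_near_add[OF t12 t23]]]
  show False using w(2) unfolding p0_def by simp
qed

theorem theorem6p2:
  fixes A B :: "(real ^ 'n) set"
  assumes "convex A" and "compact A" and "interior A \<noteq> {}"
    and "convex B" and "open B" and "bounded B"
    and "\<And>t. (\<lambda>a. a + t) ` A - B = {} \<or> cech_acyclic ((\<lambda>a. a + t) ` A - B)"
  shows "\<exists>C. C = (\<Inter>a\<in>A. (\<lambda>b. b - a) ` B) \<and> convex C \<and> A + C = B"
proof -
  define C where "C = (\<Inter>a\<in>A. (\<lambda>b. b - a) ` B)"
  have C: "c \<in> C \<longleftrightarrow> (\<forall>a\<in>A. a + c \<in> B)" for c
    unfolding C_def by (force simp: image_iff algebra_simps)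
  have "convex C" unfolding C_def by (intro convex_INT convex_translation_subtract assms)
  moreover have AC: "A + C \<subseteq> B" using C unfolding set_plus_def by blast
  moreover have "B \<subseteq> A + C"
  proof (rule ccontr)
    assume "\<not> B \<subseteq> A + C"
    then obtain b where b: "b \<in> B" "b \<notin> A + C" by blast
    have ac: "acyclic_in m ((\<lambda>a. a + t) ` A - B)" if "(\<lambda>a. a + t) ` A - B \<noteq> {}" for t m
    proof (rule acyclic_in_of_cech_acyclic[OF _ that])
      show "compact ((\<lambda>a. a + t) ` A - B)"
        by (intro compact_diff compact_continuous_image assms continuous_intros)
      show "cech_acyclic ((\<lambda>a. a + t) ` A - B)" using assms(7) that by blast
    qed
    obtain c where c: "\<And>a. a \<in> A \<Longrightarrow> a + c \<in> B"
      using exists_translate_inside[OF assms(2,5) _ ac] b(1) by blast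
    have "A \<noteq> {}" using assms(3) interior_subset by blast
    then have "A + C \<noteq> {}" using C c unfolding set_plus_def by blast
    then obtain u \<beta> where u: "u \<noteq> 0" "\<And>x. x \<in> A + C \<Longrightarrow> u \<bullet> x \<le> \<beta>" "u \<bullet> b \<ge> \<beta>"
      using separating_hyperplane_sets[of "A + C" "{b}"] convex_set_plus[OF assms(1) \<open>convex C\<close>] b(2) by auto
    have "continuous_on A (\<lambda>a. u \<bullet> a)" by (intro continuous_intros)
    then obtain a' where a': "a' \<in> A" "\<And>a. a \<in> A \<Longrightarrow> u \<bullet> a \<le> u \<bullet> a'"
      using continuous_attains_sup[OF assms(2) \<open>A \<noteq> {}\<close>] by blast
    obtain e where e: "e > 0" "ball b e \<subseteq> B" using assms(5) b(1) open_contains_ball by blast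
    \<comment> \<open>Separation yields only a weak inequality. It is strict because
      \<open>A + t\<close> is compact in the open set \<open>B\<close>, so \<open>t\<close> can
      still be pushed a little in the direction \<open>u\<close> within \<open>C\<close>.\<close>
    have lt: "u \<bullet> t < \<beta> - u \<bullet> a'" if t: "\<And>a. a \<in> A \<Longrightarrow> a + t \<in> B" for t
    proof -
      have "compact ((\<lambda>a. a + t) ` A)" by (intro compact_continuous_image assms continuous_intros)
      then obtain d where d: "d > 0" "(\<Union>x\<in>(\<lambda>a. a + t) ` A. ball x d) \<subseteq> B"
        using compact_subset_open_imp_ball_epsilon_subset[OF _ assms(5)] t by (metis image_subsetI)
      let ?v = "(d / 2 / norm u) *\<^sub>R u"
      have "norm ?v < d" using d(1) u(1) by simp
      then have "a + t + ?v \<in> ball (a + t) d" for a by (simp add: dist_norm)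
      then have "t + ?v \<in> C" unfolding C using d(2) by (fastforce simp: add.assoc)
      then have "u \<bullet> (a' + (t + ?v)) \<le> \<beta>" using a'(1) by (intro u(2) set_plus_intro)
      moreover have "u \<bullet> ?v > 0" using d(1) u(1) by simp
      ultimately show ?thesis by (simp add: inner_add_right)
    qed
    \<comment> \<open>The point \<open>b\<close> itself may lie on the separating hyperplane; moving
      it slightly along \<open>u\<close> inside \<open>B\<close> takes it strictly beyond.\<close>
    have y: "b + (e / 2 / norm u) *\<^sub>R u \<in> B" using e u(1) by (intro subsetD[OF e(2)]) (simp add: dist_norm)
    have uy: "u \<bullet> (b + (e / 2 / norm u) *\<^sub>R u) > \<beta> - u \<bullet> a' + u \<bullet> a'"
    proof -
      have "u \<bullet> ((e / 2 / norm u) *\<^sub>R u) > 0" using e(1) u(1) by simp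
      then show ?thesis using u(3) by (simp add: inner_add_right)
    qed
    show False
      by (rule no_separating_functional[OF assms(2,1,5,4,6) ac c u(1) a' lt y uy])
  qed
  ultimately show ?thesis unfolding C_def by blast
qed

end
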